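(* Let $1\leq d<n$ be integers. Let $\mathcal{L}$ be a $d$-dimensional affine subspace of $\mathbb{R}^n$ satisfying Hypothesis D. Then the induced Lebesgue measure on $\mathcal{L}$ is convergent Gallagher.
   Context: For $x\in\mathbb{R}$, $\|x\|$ is the distance from $x$ to the nearest integer. For $\psi:\mathbb{N}\to[0,1)$, $\mathcal{W}_n^\times(\psi)$ is the set of $\mathbf{x}\in\mathbb{R}^n$ such that $\prod_{i\le n}\|qx_i\|<\psi(q)$ for infinitely many $q\in\mathbb{N}$. A Borel measure $\mu$ on $\mathbb{R}^n$ is convergent Gallagher if, for every non-increasing $\psi:\mathbb{N}\to[0,1)$, $\sum_{q=1}^\infty\psi(q)(\log q)^{n-1}<\infty$ implies $\mu(\mathcal{W}_n^\times(\psi))=0$. The induced Lebesgue measure on $\mathcal{L}$ is its $d$-dimensional Lebesgue measure, regarded as a measure on $\mathbb{R}^n$. Monge parametrisations: assume that the projection of $\mathcal{L}$ onto any axis-aligned (coordinate) subspace of dimension $d$ is surjective. Then, for each of the $n!$ orderings of the standard basis of $\mathbb{R}^n$, in the correspondingly ordered coordinates one has a Monge parametrisation $\mathcal{L}=\{(\mathbf{t},A\mathbf{t}+\mathbf{b}):\mathbf{t}\in\mathbb{R}^d\}$ with $A=(\mathbf{a}^{(1)},\ldots,\mathbf{a}^{(d)})\in\mathbb{R}^{(n-d)\times d}$ (columns $\mathbf{a}^{(j)}$) and $\mathbf{b}\in\mathbb{R}^{n-d}$. For $k\in\mathbb{N}$, $\mathbf{m}\in\mathbb{Z}^k$, put $|\mathbf{m}|=\max_j|m_j|$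 and $H(\mathbf{m})=\prod_{j\le k}\max\{1,|m_j|\}$. Hypothesis $D(c,\sigma_1,\sigma_2)$, for $c>0$ and $\sigma_1,\sigma_2\in(0,\infty]$: for every Monge parametrisation $(A,\mathbf{b})$ of $\mathcal{L}$ and every $T\ge1$, the inequality $\max\{\|\boldsymbol{\xi}\cdot\mathbf{a}^{(1)}\|,\ldots,\|\boldsymbol{\xi}\cdot\mathbf{a}^{(d)}\|,\|\boldsymbol{\xi}\cdot\mathbf{b}\|\}\ge cT^{-\sigma_1}$ holds whenever $\mathbf{0}\ne\boldsymbol{\xi}\in\mathbb{Z}^{n-d}$, $|\boldsymbol{\xi}|\le T^{\sigma_2}$ and $H(\boldsymbol{\xi})\le T$. Hypothesis D: $\mathcal{L}$ satisfies the projection-surjectivity assumption above, and there exist $c>0$ and $\gamma\in[\frac{n-d}{n},1)$ such that Hypothesis $D(c,\gamma(1+d\sigma_2),\sigma_2)$ holds for all $\frac1{n-d}\le\sigma_2\le1$. *)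

theory Defs
  imports "HOL-Analysis.Analysis"
begin

definition nint_dist :: "real \<Rightarrow> real" where
  "nint_dist x = dist x (of_int (round x))"


section \<open>Multiplicative approximation\<close>

text \<open>The positive integers are the numbers \<open>q :: nat\<close> with \<open>q \<ge> 1\<close>; the value of an
  approximating function at \<open>0\<close> is never used.\<close>

definition mult_approx_set :: "(nat \<Rightarrow> real) \<Rightarrow> (real ^ 'n) set" where
  "mult_approx_set \<psi> =
     {x. infinite {q. q \<ge> 1 \<and> (\<Prod>i\<in>UNIV. nint_dist (real q * x $ i)) < \<psi> q}}"

definition convergent_gallagher :: "(real ^ 'n) measure \<Rightarrow> bool" where
  "convergent_gallagher \<mu> \<longleftrightarrow>
     sets \<mu> = sets borel \<and>
     (\<forall>\<psi>. (\<forall>q\<ge>1. 0 \<le> \<psi> q \<and> \<psi> q < 1) \<longrightarrow>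
          (\<forall>q\<ge>1. \<forall>r\<ge>q. \<psi> r \<le> \<psi> q) \<longrightarrow>
          summable (\<lambda>q. \<psi> (Suc q) * ln (real (Suc q)) ^ (CARD('n) - 1)) \<longrightarrow>
          mult_approx_set \<psi> \<in> null_sets \<mu>)"


section \<open>Lebesgue measure on an affine subspace\<close>

text \<open>For \<open>orthonormal_frame d L p u\<close>, the map \<open>t \<mapsto> p + \<Sum>i<d. t i *\<^sub>R u i\<close> is an isometry
  from \<open>d\<close>-dimensional Euclidean space onto \<open>L\<close>.\<close>

definition orthonormal_frame ::
    "nat \<Rightarrow> (real ^ 'n) set \<Rightarrow> real ^ 'n \<Rightarrow> (nat \<Rightarrow> real ^ 'n) \<Rightarrow> bool" where
  "orthonormal_frame d L p u \<longleftrightarrow>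
     (\<forall>i<d. \<forall>j<d. u i \<bullet> u j = (if i = j then 1 else 0)) \<and>
     L = range (\<lambda>t. p + (\<Sum>i<d. t i *\<^sub>R u i))"

text \<open>The push-forward of \<open>d\<close>-dimensional Lebesgue measure under such an isometry. Two frames
  of \<open>L\<close> differ by an isometry of \<open>d\<close>-dimensional Euclidean space, so the result does not depend
  on the frame chosen. A frame exists by lemma \<open>ex_orthonormal_frame\<close> below.\<close>

definition induced_lebesgue :: "nat \<Rightarrow> (real ^ 'n) set \<Rightarrow> (real ^ 'n) measure" where
  "induced_lebesgue d L =
     (case SOME (p, u). orthonormal_frame d L p u of (p, u) \<Rightarrow>
        distr (Pi\<^sub>M {..<d} (\<lambda>_. lborel)) borel (\<lambda>t. p + (\<Sum>i<d. t i *\<^sub>R u i)))"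

lemma ex_orthonormal_frame:
  fixes L :: "(real ^ 'n) set"
  assumes "affine L" and "aff_dim L = int d"
  shows "\<exists>p u. orthonormal_frame d L p u"
proof -
  have "L \<noteq> {}" using assms(2) by auto
  then obtain p where p: "p \<in> L" by blast
  define V where "V = (\<lambda>x. x - p) ` L"
  have sub: "subspace V"
    unfolding V_def using affine_diffs_subspace_subtract[OF assms(1) p] by (simp add: image_def)
  have dimV: "dim V = d"
  proof -
    have "aff_dim V = aff_dim L"
      unfolding V_def using aff_dim_translation_eq[of "- p" L] by (simp add: algebra_simps)
    then show ?thesis using aff_dim_subspace[OF sub] assms(2) by simp
  qed
  obtain B where B: "pairwise orthogonal B" "\<And>x. x \<in> B \<Longrightarrow> norm x = 1"
      "independent B" "card B = dim V" "span B = V"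
    using orthonormal_basis_subspace[OF sub] by metis
  have "finite B" using B(3) by (simp add: independent_imp_finite)
  then obtain u where u: "bij_betw u {0..<card B} B" using ex_bij_betw_nat_finite by blast
  have u': "bij_betw u {..<d} B" using u B(4) dimV by (simp add: atLeast0LessThan)
  have on: "u i \<bullet> u j = (if i = j then 1 else 0)" if "i < d" "j < d" for i j
  proof (cases "i = j")
    case True
    have "u i \<in> B" using u' that by (auto simp: bij_betw_def)
    then show ?thesis using B(2) True by (simp add: dot_square_norm)
  next
    case False
    have "u i \<in> B" "u j \<in> B" "u i \<noteq> u j"
      using u' that False by (auto simp: bij_betw_def inj_on_def)
    then show ?thesis using B(1) False by (auto simp: pairwise_def orthogonal_def)
  qed
  have V: "V = range (\<lambda>t. \<Sum>i<d. t i *\<^sub>R u i)"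
  proof -
    have "V = range (\<lambda>c. \<Sum>v\<in>B. c v *\<^sub>R v)"
      using B(5) span_finite[OF \<open>finite B\<close>] by simp
    also have "\<dots> = range (\<lambda>t. \<Sum>i<d. t i *\<^sub>R u i)"
    proof (intro equalityI subsetI)
      fix x assume "x \<in> range (\<lambda>c. \<Sum>v\<in>B. c v *\<^sub>R v)"
      then obtain c where "x = (\<Sum>v\<in>B. c v *\<^sub>R v)" by blast
      also have "\<dots> = (\<Sum>i<d. c (u i) *\<^sub>R u i)"
        using sum.reindex_bij_betw[OF u', of "\<lambda>v. c v *\<^sub>R v"] by simp
      finally show "x \<in> range (\<lambda>t. \<Sum>i<d. t i *\<^sub>R u i)"
        by (intro image_eqI[where x = "c \<circ> u"]) simp_all
    next
      fix x assume "x \<in> range (\<lambda>t. \<Sum>i<d. t i *\<^sub>R u i)"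
      then obtain t where "x = (\<Sum>i<d. t i *\<^sub>R u i)" by blast
      also have "\<dots> = (\<Sum>i<d. t (inv_into {..<d} u (u i)) *\<^sub>R u i)"
        using u' by (intro sum.cong) (auto simp: bij_betw_def inv_into_f_f)
      also have "\<dots> = (\<Sum>v\<in>B. t (inv_into {..<d} u v) *\<^sub>R v)"
        using sum.reindex_bij_betw[OF u', of "\<lambda>v. t (inv_into {..<d} u v) *\<^sub>R v"] by simp
      finally show "x \<in> range (\<lambda>c. \<Sum>v\<in>B. c v *\<^sub>R v)"
        by (intro image_eqI[where x = "\<lambda>v. t (inv_into {..<d} u v)"]) simp_all
    qed
    finally show ?thesis .
  qed
  have "L = (\<lambda>v. p + v) ` V" unfolding V_def by (simp add: image_image)
  also have "\<dots> = range (\<lambda>t. p + (\<Sum>i<d. t i *\<^sub>R u i))" unfolding V by (simp add: image_image)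
  finally show ?thesis using on unfolding orthonormal_frame_def by blast
qed


section \<open>Monge parametrisations and the Diophantine hypothesis\<close>

definition coord_proj :: "'n set \<Rightarrow> real ^ 'n \<Rightarrow> real ^ 'n" where
  "coord_proj I x = (\<chi> i. if i \<in> I then x $ i else 0)"

definition coord_subspace :: "'n set \<Rightarrow> (real ^ 'n) set" where
  "coord_subspace I = {y. \<forall>i. i \<notin> I \<longrightarrow> y $ i = 0}"

definition surjective_projections :: "nat \<Rightarrow> (real ^ 'n) set \<Rightarrow> bool" where
  "surjective_projections d L \<longleftrightarrow>
     (\<forall>I. card I = d \<longrightarrow> coord_proj I ` L = coord_subspace I)"

text \<open>The ordering of the coordinates is given by \<open>e\<close>: the first \<open>d\<close> of them are the parameters
  \<open>t\<close>. Rows of \<open>A\<close> and entries of \<open>b\<close> are numbered \<open>0, \<dots>, n - d - 1\<close>, columns of \<open>A\<close> are numbered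
  \<open>0, \<dots>, d - 1\<close>; the column \<open>j\<close> is \<open>\<lambda>i. A i j\<close>. Entries outside this range are irrelevant.\<close>

definition monge_parametrisation ::
    "nat \<Rightarrow> (real ^ 'n) set \<Rightarrow> (nat \<Rightarrow> 'n) \<Rightarrow> (nat \<Rightarrow> nat \<Rightarrow> real) \<Rightarrow> (nat \<Rightarrow> real) \<Rightarrow> bool" where
  "monge_parametrisation d L e A b \<longleftrightarrow>
     bij_betw e {..<CARD('n)} UNIV \<and>
     L = {x. \<exists>t :: nat \<Rightarrow> real.
            (\<forall>j<d. x $ e j = t j) \<and>
            (\<forall>i<CARD('n) - d. x $ e (d + i) = (\<Sum>j<d. A i j * t j) + b i)}"

definition int_dot :: "nat \<Rightarrow> (nat \<Rightarrow> int) \<Rightarrow> (nat \<Rightarrow> real) \<Rightarrow> real" where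
  "int_dot k m v = (\<Sum>i<k. real_of_int (m i) * v i)"

text \<open>The next two are used for \<open>k \<ge> 1\<close> only.\<close>

definition sup_norm_int :: "nat \<Rightarrow> (nat \<Rightarrow> int) \<Rightarrow> int" where
  "sup_norm_int k m = Max ((\<lambda>i. \<bar>m i\<bar>) ` {..<k})"

definition mult_height :: "nat \<Rightarrow> (nat \<Rightarrow> int) \<Rightarrow> int" where
  "mult_height k m = (\<Prod>i<k. max 1 \<bar>m i\<bar>)"

text \<open>The exponents are finite here: the value \<open>\<infinity>\<close>, sometimes allowed for \<open>\<sigma>\<^sub>1\<close> and \<open>\<sigma>\<^sub>2\<close>, does not
  occur in \<open>hypothesis_D\<close>.\<close>

definition hypothesis_D_at :: "nat \<Rightarrow> (real ^ 'n) set \<Rightarrow> real \<Rightarrow> real \<Rightarrow> real \<Rightarrow> bool" where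
  "hypothesis_D_at d L c \<sigma>\<^sub>1 \<sigma>\<^sub>2 \<longleftrightarrow>
     (let k = CARD('n) - d in
      \<forall>e A b. monge_parametrisation d L e A b \<longrightarrow>
        (\<forall>T\<ge>1. \<forall>\<xi> :: nat \<Rightarrow> int.
           (\<exists>i<k. \<xi> i \<noteq> 0) \<longrightarrow>
           real_of_int (sup_norm_int k \<xi>) \<le> T powr \<sigma>\<^sub>2 \<longrightarrow>
           real_of_int (mult_height k \<xi>) \<le> T \<longrightarrow>
           Max (insert (nint_dist (int_dot k \<xi> b))
                  ((\<lambda>j. nint_dist (int_dot k \<xi> (\<lambda>i. A i j))) ` {..<d}))
             \<ge> c * T powr (- \<sigma>\<^sub>1)))"

definition hypothesis_D :: "nat \<Rightarrow> (real ^ 'n) set \<Rightarrow> bool" where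
  "hypothesis_D d L \<longleftrightarrow>
     surjective_projections d L \<and>
     (\<exists>c>0. \<exists>\<gamma>. (real CARD('n) - real d) / real CARD('n) \<le> \<gamma> \<and> \<gamma> < 1 \<and>
        (\<forall>\<sigma>\<^sub>2. 1 / (real CARD('n) - real d) \<le> \<sigma>\<^sub>2 \<and> \<sigma>\<^sub>2 \<le> 1 \<longrightarrow>
           hypothesis_D_at d L c (\<gamma> * (1 + real d * \<sigma>\<^sub>2)) \<sigma>\<^sub>2))"

end

theory Submission
  imports Defs
begin

text \<open>
  The proof is a convergence Borel--Cantelli argument over dyadic blocks \<open>2^m \<le> q < 2^(m+1)\<close>.
  Put \<open>Q = 2^m\<close> and let \<open>2^(-s)\<close> be the least power of two that is at least
  \<open>\<Psi> = max (\<psi> Q) (Q^(-1/\<gamma>))\<close>; the second entry has a convergent sum of its own because \<open>\<gamma> < 1\<close>,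
  and it forces \<open>\<gamma> s \<le> m\<close>. If \<open>\<Prod> \<parallel>q x\<^sub>i\<parallel> < \<psi> q\<close>, then for some \<open>k\<close> with \<open>\<Sum> k\<^sub>i = s\<close> all the
  inequalities \<open>\<parallel>q x\<^sub>i\<parallel> \<le> 2 \<cdot> 2^(-k\<^sub>i)\<close> hold (\<open>small_prod_dyadic_cover\<close>). There are at most
  \<open>(s+1)^(n-1)\<close> such \<open>k\<close>, and \<open>s\<close> is at most a constant times \<open>m\<close>, that is \<open>log Q\<close>. So everything follows
  from Cauchy condensation once each \<open>k\<close> contributes a set of measure \<open>O(Q 2^(-s))\<close>, which is
  the expected order (\<open>near_box_measure\<close>).

  For that bound, order the coordinates so that \<open>k\<close> decreases and use the Monge parametrisation
  belonging to this order: the \<open>d\<close> parameters are the coordinates with the sharpest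
  conditions. They place the parameters within \<open>O(2^(-k\<^sub>j)/Q)\<close> of a rational point \<open>y'/q\<close>, and because the
  other conditions are weaker, replacing the parameters by \<open>y'/q\<close> in them costs only a constant. So
  the measure is at most the measure of one slab (\<open>monge_slab_measure\<close>) times the number
  of integer vectors \<open>y = (y', q)\<close> of size \<open>O(Q)\<close> for which the linear forms \<open>(A | b) y\<close> are close to
  integers. The required bound for this number is the volume bound
  \<open>O(Q^(d+1) \<Prod> 2^(-k\<^sub>i))\<close>, the product being over the \<open>n - d\<close> dependent coordinates.

  Counting is done by duality (\<open>count_near_integer_points\<close>). Detecting near-integrality with
  exponential sums over boxes of integer vectors \<open>\<xi>\<close> with \<open>\<bar>\<xi>\<^sub>i\<bar> < 2^(k\<^sub>i)\<close> and exchanging the roles of \<open>\<xi>\<close> and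
  \<open>y\<close>, as in the dual form of the large sieve, one obtains the volume bound provided that the points
  \<open>\<xi> (A | b)\<close> are \<open>c/Q\<close>-separated modulo 1. A difference of two such points belongs to a nonzero \<open>\<xi>\<close> of the same kind, so this is what Hypothesis D says for
  \<open>T = 2^K\<close> and \<open>\<sigma>\<^sub>2 = \<kappa>/K\<close>, where \<open>K\<close> is the sum and \<open>\<kappa>\<close> the maximum of the \<open>k\<^sub>i\<close> of the dependent
  coordinates: it gives \<open>c T^(-\<gamma>(1 + d \<sigma>\<^sub>2)) = c 2^(-\<gamma>(K + d \<kappa>))\<close>, and
  \<open>K + d \<kappa> \<le> s\<close> because the \<open>d\<close> parameters have exponents at least \<open>\<kappa>\<close>; finally
  \<open>2^(-\<gamma> s) \<ge> 1/Q\<close> (\<open>hypothesis_D_separation\<close>).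
\<close>

section \<open>Distance to the nearest integer and exponential sums\<close>

lemma nint_dist_eq: "nint_dist x = \<bar>x - of_int (round x)\<bar>"
  by (simp add: nint_dist_def dist_real_def)

lemma nint_dist_nonneg [simp]: "0 \<le> nint_dist x"
  by (simp add: nint_dist_def)

lemma nint_dist_le_dist_int: "nint_dist x \<le> \<bar>x - of_int z\<bar>"
  unfolding nint_dist_eq by (rule round_diff_minimal)

lemma nint_dist_le_perturb: "nint_dist x \<le> nint_dist y + \<bar>x - y\<bar>"
  using nint_dist_le_dist_int[of x "round y"] by (simp add: nint_dist_eq)

lemma nint_dist_le_half: "nint_dist x \<le> 1 / 2"
  unfolding nint_dist_eq using of_int_round_abs_le[of x] by (simp add: abs_minus_commute)

lemma borel_measurable_nint_dist [measurable]: "nint_dist \<in> borel_measurable borel"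
proof -
  have "1-lipschitz_on UNIV nint_dist"
    using nint_dist_le_perturb by (auto intro!: lipschitz_onI simp: dist_real_def abs_le_iff)
      (smt (verit) nint_dist_le_perturb)+
  then show ?thesis
    by (intro borel_measurable_continuous_onI lipschitz_on_continuous_on)
qed

definition expi :: "real \<Rightarrow> complex" where
  "expi x = cis (2 * pi * x)"

lemma expi_add: "expi (x + y) = expi x * expi y"
  by (simp add: expi_def cis_mult ring_distribs)

lemma expi_minus: "expi (- x) = cnj (expi x)"
  by (simp add: expi_def cis_cnj)

lemma expi_0 [simp]: "expi 0 = 1"
  by (simp add: expi_def)

lemma norm_expi [simp]: "norm (expi x) = 1"
  by (simp add: expi_def)

lemma expi_of_int [simp]: "expi (of_int z) = 1"
  unfolding expi_def using cis_multiple_2pi[of "of_int z"] by (simp add: mult.commute)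

lemma expi_sum: "finite I \<Longrightarrow> expi (\<Sum>i\<in>I. f i) = (\<Prod>i\<in>I. expi (f i))"
  by (induction I rule: finite_induct) (simp_all add: expi_add)

lemma expi_diff_round: "expi (x - of_int (round x)) = expi x"
  using expi_add[of x "- of_int (round x)"] expi_of_int[of "- round x"] by simp

lemma expi_of_nat_mult: "expi (real u * x) = expi x ^ u"
  by (induction u) (simp_all add: expi_add ring_distribs)

lemma sin_ge_third:
  fixes t :: real
  assumes "0 \<le> t" "t \<le> 2"
  shows "t / 3 \<le> sin t"
proof -
  have "\<bar>sin t - (\<Sum>m<3. sin_coeff m * t ^ m)\<bar> \<le> inverse (fact 3) * \<bar>t\<bar> ^ 3"
    by (rule Maclaurin_sin_bound)
  then have "\<bar>sin t - t\<bar> \<le> t ^ 3 / 6"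
    using assms by (simp add: eval_nat_numeral sin_coeff_def fact_numeral)
  moreover have "t ^ 3 \<le> 4 * t"
    using assms mult_mono[of t 2 t 2] mult_right_mono[of "t * t" 4 t]
    by (simp add: power3_eq_cube)
  ultimately show ?thesis by linarith
qed

text \<open>If \<open>y\<close> is the signed distance to the nearest integer, the right-hand side is \<open>2 \<bar>sin (pi y)\<bar>\<close>. The crude
  bound \<open>sin t \<ge> t/3\<close> is enough, \<open>pi\<close> being larger than 3.\<close>

lemma norm_one_minus_expi_ge: "2 * nint_dist x \<le> norm (1 - expi x)"
proof -
  define y where "y = x - of_int (round x)"
  have y: "\<bar>y\<bar> = nint_dist x" "\<bar>y\<bar> \<le> 1 / 2" "expi y = expi x"
    using nint_dist_le_half[of x] by (auto simp: y_def nint_dist_eq expi_diff_round)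
  have "(norm (1 - expi y))\<^sup>2 = (2 * \<bar>sin (pi * y)\<bar>)\<^sup>2"
  proof -
    have alg: "(1 - (1 - 2 * s\<^sup>2))\<^sup>2 + (2 * s * c)\<^sup>2 = (2 * \<bar>s\<bar>)\<^sup>2 * (s\<^sup>2 + c\<^sup>2)"
      for s c :: real by (simp add: power_mult_distrib algebra_simps power2_eq_square)
    have "(norm (1 - expi y))\<^sup>2 = (1 - cos (2 * (pi * y)))\<^sup>2 + (sin (2 * (pi * y)))\<^sup>2"
      by (simp add: cmod_power2 expi_def mult.assoc)
    also have "\<dots> = (2 * \<bar>sin (pi * y)\<bar>)\<^sup>2 * ((sin (pi * y))\<^sup>2 + (cos (pi * y))\<^sup>2)"
      unfolding cos_double_sin sin_double by (rule alg)
    finally show ?thesis by simp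
  qed
  then have eq: "norm (1 - expi y) = 2 * \<bar>sin (pi * y)\<bar>"
    by (subst (asm) power2_eq_iff_nonneg) auto
  have "pi * \<bar>y\<bar> \<le> 4 * (1/2)"
    using y(2) pi_less_4 by (intro mult_mono) auto
  then have "pi * \<bar>y\<bar> / 3 \<le> sin (pi * \<bar>y\<bar>)"
    by (intro sin_ge_third) auto
  moreover have "sin (pi * \<bar>y\<bar>) \<le> \<bar>sin (pi * y)\<bar>" by (cases "y \<ge> 0") auto
  moreover have "3 * \<bar>y\<bar> \<le> pi * \<bar>y\<bar>" using pi_gt3 by (intro mult_right_mono) auto
  ultimately show ?thesis using eq unfolding y(1)[symmetric] y(3)[symmetric] by linarith
qed

text \<open>The geometric series bound \<open>\<bar>S\<bar> \<le> 1/\<parallel>x\<parallel>\<close>, multiplied out so that it also holds when \<open>\<parallel>x\<parallel> = 0\<close>.\<close>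

lemma expi_partial_sum_bound:
  "nint_dist x ^ 2 * norm (\<Sum>u<P. expi (real u * x)) ^ 2 \<le> 1"
proof (cases "expi x = 1")
  case True
  then have "nint_dist x \<le> 0" using norm_one_minus_expi_ge[of x] by simp
  then have "nint_dist x = 0" using nint_dist_nonneg[of x] by linarith
  then show ?thesis by simp
next
  case False
  let ?S = "\<Sum>u<P. expi (real u * x)"
  have "(1 - expi x) * ?S = 1 - expi x ^ P"
    by (simp add: expi_of_nat_mult one_diff_power_eq)
  then have "norm (1 - expi x) * norm ?S = norm (1 - expi x ^ P)"
    by (metis norm_mult)
  also have "\<dots> \<le> 1 + 1"
    by (rule order_trans[OF norm_triangle_ineq4]) (simp add: norm_power)
  finally have "norm (1 - expi x) * norm ?S \<le> 2" by simp
  moreover have "2 * nint_dist x * norm ?S \<le> norm (1 - expi x) * norm ?S"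
    by (intro mult_right_mono norm_one_minus_expi_ge) auto
  ultimately have "nint_dist x * norm ?S \<le> 1" by linarith
  then have "(nint_dist x * norm ?S) ^ 2 \<le> 1"
    by (intro power_le_one) auto
  then show ?thesis by (simp add: power_mult_distrib)
qed

lemma norm_expi_sum_le: "norm (\<Sum>u\<in>U. expi (f u)) \<le> card U"
  by (rule order_trans[OF norm_sum]) simp

text \<open>While \<open>M \<parallel>x\<parallel> \<le> 1/8\<close>, every phase stays within an eighth of a turn of 0, so no term has real
  part below \<open>1/2\<close> and there is no cancellation. The alternative \<open>M = 1\<close> covers coordinates on which
  no condition is imposed.\<close>

lemma expi_partial_sum_ge:
  assumes "M = 1 \<or> real M * nint_dist x \<le> 1 / 8"
  shows "real M / 2 \<le> norm (\<Sum>u<M. expi (real u * x))"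
proof (cases "M = 1")
  case True
  then show ?thesis by simp
next
  case False
  define y where "y = x - of_int (round x)"
  have y: "\<bar>y\<bar> = nint_dist x" "expi y = expi x"
    by (auto simp: y_def nint_dist_eq expi_diff_round)
  have re: "1 / 2 \<le> Re (expi (real u * y))" if "u < M" for u
  proof -
    define t where "t = pi * (real u * y)"
    have "real u * \<bar>y\<bar> \<le> real M * \<bar>y\<bar>" using that by (intro mult_right_mono) auto
    then have "real u * \<bar>y\<bar> \<le> 1 / 8" using assms False y by auto
    then have "\<bar>t\<bar> \<le> 4 * (1 / 8)"
      unfolding t_def abs_mult using pi_less_4 by (intro mult_mono) auto
    then have "\<bar>sin t\<bar> \<le> 1 / 2" using abs_sin_x_le_abs_x[of t] by linarith
    then have "\<bar>sin t\<bar>\<^sup>2 \<le> (1 / 2)\<^sup>2" by (intro power_mono) auto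
    then have "(sin t)\<^sup>2 \<le> 1 / 4" by (simp add: power2_eq_square)
    moreover have "Re (expi (real u * y)) = 1 - 2 * (sin t)\<^sup>2"
      unfolding expi_def t_def by (simp add: cos_double_sin[symmetric] mult.assoc)
    ultimately show ?thesis by simp
  qed
  have "real M / 2 = (\<Sum>u<M. 1 / 2)" by simp
  also have "\<dots> \<le> Re (\<Sum>u<M. expi (real u * y))"
    unfolding Re_sum by (intro sum_mono re) auto
  also have "\<dots> \<le> norm (\<Sum>u<M. expi (real u * y))"
    by (rule complex_Re_le_cmod)
  finally show ?thesis by (simp add: expi_of_nat_mult y)
qed

section \<open>Counting integer vectors by duality\<close>

lemma norm_sum_expi_squared:
  assumes "finite I"
  shows "complex_of_real ((norm (\<Sum>i\<in>I. expi (f i)))\<^sup>2) = (\<Sum>i\<in>I. \<Sum>j\<in>I. expi (f i - f j))"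
proof -
  have "complex_of_real ((norm (\<Sum>i\<in>I. expi (f i)))\<^sup>2) =
      (\<Sum>i\<in>I. expi (f i)) * cnj (\<Sum>i\<in>I. expi (f i))"
    by (simp only: complex_norm_square)
  also have "\<dots> = (\<Sum>i\<in>I. \<Sum>j\<in>I. expi (f i - f j))"
    by (simp add: sum_product expi_add[of "f _" "- f _", simplified] expi_minus)
  finally show ?thesis .
qed

text \<open>Both sides are the sum of \<open>expi (B x u - B x u' - B x' u + B x' u')\<close> over all quadruples.\<close>

lemma expi_duality:
  assumes "finite U" "finite X"
  shows "(\<Sum>u\<in>U. \<Sum>u'\<in>U. (norm (\<Sum>x\<in>X. expi (B x u - B x u')))\<^sup>2) =
         (\<Sum>x\<in>X. \<Sum>x'\<in>X. (norm (\<Sum>u\<in>U. expi (B x u - B x' u)))\<^sup>2)" (is "?l = ?r")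
proof -
  let ?e = "\<lambda>u u' x x'. expi (B x u - B x u' - (B x' u - B x' u'))"
  have "complex_of_real ?l = (\<Sum>u\<in>U. \<Sum>u'\<in>U. \<Sum>x\<in>X. \<Sum>x'\<in>X. ?e u u' x x')"
    by (simp only: of_real_sum norm_sum_expi_squared[OF assms(2)])
  also have "\<dots> = (\<Sum>u\<in>U. \<Sum>x\<in>X. \<Sum>x'\<in>X. \<Sum>u'\<in>U. ?e u u' x x')"
    by (intro sum.cong refl) (subst sum.swap, intro sum.cong refl, subst sum.swap, rule refl)
  also have "\<dots> = (\<Sum>x\<in>X. \<Sum>x'\<in>X. \<Sum>u\<in>U. \<Sum>u'\<in>U. ?e u u' x x')"
    by (subst sum.swap, intro sum.cong refl, subst sum.swap, rule refl)
  also have "\<dots> = (\<Sum>x\<in>X. \<Sum>x'\<in>X. \<Sum>u\<in>U. \<Sum>u'\<in>U. expi ((B x u - B x' u) - (B x u' - B x' u')))"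
    by (intro sum.cong refl arg_cong[of _ _ expi]) simp
  also have "\<dots> = complex_of_real ?r"
    by (simp only: of_real_sum norm_sum_expi_squared[OF assms(1)])
  finally show ?thesis by (simp only: of_real_eq_iff)
qed

text \<open>The bound \<open>5 - 4/(K+1)\<close> for the sum over \<open>\<bar>\<kappa>\<bar> \<le> K\<close> is chosen so that the induction on \<open>K\<close>
  closes: \<open>2/(1+(K+1)^2) \<le> 4/((K+1)(K+2))\<close>.\<close>

lemma sum_inverse_one_plus_square_le:
  assumes "finite F"
  shows "(\<Sum>\<kappa>\<in>F. 1 / (1 + (real_of_int \<kappa>)\<^sup>2)) \<le> 5"
proof -
  have main: "(\<Sum>\<kappa>=-int K..int K. 1 / (1 + (real_of_int \<kappa>)\<^sup>2)) \<le> 5 - 4 / (real K + 1)" for K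
  proof (induction K)
    case (Suc K)
    have "{-int (Suc K)..int (Suc K)} = insert (- int (Suc K)) (insert (int (Suc K)) {-int K..int K})"
      by auto
    then have "(\<Sum>\<kappa>=-int (Suc K)..int (Suc K). 1 / (1 + (real_of_int \<kappa>)\<^sup>2)) =
        2 / (1 + (real K + 1)\<^sup>2) + (\<Sum>\<kappa>=-int K..int K. 1 / (1 + (real_of_int \<kappa>)\<^sup>2))"
      by (simp add: algebra_simps power2_eq_square)
    also have "2 / (1 + (real K + 1)\<^sup>2) \<le> 4 / (real K + 1) - 4 / (real (Suc K) + 1)"
      by (simp add: field_simps power2_eq_square add_pos_nonneg)
    finally show ?case using Suc by simp
  qed simp
  obtain K where "\<forall>\<kappa>\<in>F. nat \<bar>\<kappa>\<bar> \<le> K"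
    using assms by (meson finite_nat_set_iff_bounded_le finite_imageI imageI)
  then have "F \<subseteq> {-int K..int K}" by force
  then have "(\<Sum>\<kappa>\<in>F. 1 / (1 + (real_of_int \<kappa>)\<^sup>2)) \<le>
      (\<Sum>\<kappa>=-int K..int K. 1 / (1 + (real_of_int \<kappa>)\<^sup>2))"
    by (intro sum_mono2) auto
  also have "\<dots> \<le> 5 - 4 / (real K + 1)" by (rule main)
  also have "\<dots> \<le> 5" by simp
  finally show ?thesis .
qed

text \<open>Cut the circle into cells of length \<open>r\<close>, with \<open>\<kappa>\<close> the index of the cell of \<open>x\<close>. In the two cells at 0 the
  trivial bound \<open>P\<close> is used, in the others the geometric series bound; a single expression that
  is summable over \<open>\<kappa>\<close> dominates both.\<close>

lemma expi_partial_sum_cell_bound: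
  fixes r :: real
  assumes "r > 0"
  shows "norm (\<Sum>u<P. expi (real u * x)) ^ 2 \<le>
    (2 * real P ^ 2 + 8 / r ^ 2) / (1 + (real_of_int \<lfloor>(x - of_int (round x)) / r\<rfloor>)\<^sup>2)"
proof -
  define y where "y = x - of_int (round x)"
  define \<kappa> where "\<kappa> = \<lfloor>y / r\<rfloor>"
  let ?S = "norm (\<Sum>u<P. expi (real u * x)) ^ 2"
  have y: "\<bar>y\<bar> = nint_dist x" by (simp add: y_def nint_dist_eq)
  have "real_of_int \<kappa> \<le> y / r" "y / r \<le> real_of_int \<kappa> + 1"
    unfolding \<kappa>_def by linarith+
  then have \<kappa>: "r * real_of_int \<kappa> \<le> y" "y \<le> r * (real_of_int \<kappa> + 1)"
    using assms by (simp_all add: pos_le_divide_eq pos_divide_le_eq mult.commute)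
  have pos: "0 < 1 + (real_of_int \<kappa>)\<^sup>2" by (simp add: add_pos_nonneg)
  have S: "?S \<le> real P ^ 2"
    using norm_expi_sum_le[of "\<lambda>u. real u * x" "{..<P}"] by (intro power_mono) auto
  have "?S * (1 + (real_of_int \<kappa>)\<^sup>2) \<le> 2 * real P ^ 2 + 8 / r ^ 2"
  proof (cases "\<kappa> = 0 \<or> \<kappa> = -1")
    case True
    then have "(1 + (real_of_int \<kappa>)\<^sup>2) \<le> 2" by auto
    then have "?S * (1 + (real_of_int \<kappa>)\<^sup>2) \<le> real P ^ 2 * 2"
      using S by (intro mult_mono) auto
    then show ?thesis using assms by (simp add: add_increasing2)
  next
    case False
    have "r * \<bar>real_of_int \<kappa>\<bar> \<le> 2 * \<bar>y\<bar>"
    proof (cases "\<kappa> > 0")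
      case True
      then have "0 \<le> r * real_of_int \<kappa>" using assms by simp
      then show ?thesis using True \<kappa>(1) by simp
    next
      case neg: False
      then have "real_of_int \<kappa> \<le> -2" using False by linarith
      then have "r * (real_of_int \<kappa> + 1) \<le> r * (real_of_int \<kappa> / 2)"
        using assms by (intro mult_left_mono) auto
      moreover have "r * \<bar>real_of_int \<kappa>\<bar> = - (r * real_of_int \<kappa>)" using neg by simp
      ultimately show ?thesis using \<kappa>(2) by (simp add: field_simps)
    qed
    then have "(r * \<bar>real_of_int \<kappa>\<bar>)\<^sup>2 \<le> (2 * \<bar>y\<bar>)\<^sup>2"
      using assms by (intro power_mono) auto
    then have a: "r\<^sup>2 * (real_of_int \<kappa>)\<^sup>2 \<le> 4 * nint_dist x ^ 2"
      by (simp add: power_mult_distrib flip: y)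
    have "1 \<le> \<bar>real_of_int \<kappa>\<bar>" using False by linarith
    then have "1 \<le> (real_of_int \<kappa>)\<^sup>2" by (metis one_le_power power2_abs)
    then have "r\<^sup>2 * (1 + (real_of_int \<kappa>)\<^sup>2) \<le> 2 * (r\<^sup>2 * (real_of_int \<kappa>)\<^sup>2)"
      using assms by (simp add: algebra_simps)
    then have "r\<^sup>2 * (1 + (real_of_int \<kappa>)\<^sup>2) \<le> 8 * nint_dist x ^ 2" using a by simp
    then have "?S * (r\<^sup>2 * (1 + (real_of_int \<kappa>)\<^sup>2)) \<le> ?S * (8 * nint_dist x ^ 2)"
      by (intro mult_left_mono) auto
    also have "\<dots> \<le> 8" using expi_partial_sum_bound[of x P] by (simp add: mult.commute)
    finally have "?S * (1 + (real_of_int \<kappa>)\<^sup>2) \<le> 8 / r ^ 2"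
      using assms by (simp add: field_simps)
    then show ?thesis by (simp add: add_increasing)
  qed
  then show ?thesis
    unfolding \<kappa>_def[symmetric] y_def[symmetric] using pos by (simp add: pos_le_divide_eq)
qed

text \<open>Separated points lie in distinct cells of side \<open>r\<close>, so the sum over points is at most the sum
  over cells, which factorises over the coordinates.\<close>

lemma separated_expi_sum_bound:
  fixes \<theta> :: "'x \<Rightarrow> nat \<Rightarrow> real" and r :: real
  assumes "finite X" "r > 0"
    and sep: "\<And>x x'. x \<in> X \<Longrightarrow> x' \<in> X \<Longrightarrow> x \<noteq> x' \<Longrightarrow>
      \<exists>j<D. r \<le> nint_dist (\<theta> x j - \<theta> x' j)"
  shows "(\<Sum>x\<in>X. \<Prod>j<D. norm (\<Sum>u<P. expi (real u * \<theta> x j)) ^ 2) \<le>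
      (5 * (2 * real P ^ 2 + 8 / r ^ 2)) ^ D"
proof -
  define W where "W = 2 * real P ^ 2 + 8 / r ^ 2"
  define w where "w = (\<lambda>\<kappa>::int. W * (1 / (1 + (real_of_int \<kappa>)\<^sup>2)))"
  have W: "W \<ge> 0" using assms by (simp add: W_def)
  have w: "w \<kappa> \<ge> 0" for \<kappa> unfolding w_def by (intro mult_nonneg_nonneg W) simp
  define fr where "fr = (\<lambda>x j. \<theta> x j - of_int (round (\<theta> x j)))"
  define cell where "cell = (\<lambda>x. \<lambda>j\<in>{..<D}. \<lfloor>fr x j / r\<rfloor>)"
  define F where "F = (\<Union>x\<in>X. \<Union>j<D. {cell x j})"
  have F: "finite F" unfolding F_def using assms by auto
  have inj: "inj_on cell X"
  proof (rule inj_onI, rule ccontr)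
    fix x x' assume x: "x \<in> X" "x' \<in> X" "cell x = cell x'" "x \<noteq> x'"
    obtain j where j: "j < D" "r \<le> nint_dist (\<theta> x j - \<theta> x' j)" using sep x by blast
    have "\<lfloor>fr x j / r\<rfloor> = \<lfloor>fr x' j / r\<rfloor>"
      using fun_cong[OF x(3), of j] j(1) by (simp add: cell_def)
    then have "\<bar>fr x j / r - fr x' j / r\<bar> < 1" by linarith
    then have "\<bar>fr x j - fr x' j\<bar> < r"
      using assms(2) by (simp add: field_simps abs_if split: if_splits)
    moreover have "nint_dist (\<theta> x j - \<theta> x' j) \<le> \<bar>fr x j - fr x' j\<bar>"
      using nint_dist_le_dist_int[of "\<theta> x j - \<theta> x' j" "round (\<theta> x j) - round (\<theta> x' j)"]
      by (simp add: fr_def algebra_simps)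
    ultimately show False using j by linarith
  qed
  have "(\<Sum>x\<in>X. \<Prod>j<D. norm (\<Sum>u<P. expi (real u * \<theta> x j)) ^ 2) \<le> (\<Sum>x\<in>X. \<Prod>j<D. w (cell x j))"
  proof (intro sum_mono prod_mono conjI)
    fix x j assume "j \<in> {..<D}"
    then show "norm (\<Sum>u<P. expi (real u * \<theta> x j)) ^ 2 \<le> w (cell x j)"
      using expi_partial_sum_cell_bound[OF assms(2), where P = P and x = "\<theta> x j"]
      by (simp add: w_def W_def cell_def fr_def)
  qed simp
  also have "\<dots> = (\<Sum>g\<in>cell ` X. \<Prod>j<D. w (g j))"
    using inj by (simp add: sum.reindex)
  also have "\<dots> \<le> (\<Sum>g\<in>PiE {..<D} (\<lambda>_. F). \<Prod>j<D. w (g j))"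
  proof (rule sum_mono2)
    show "finite (PiE {..<D} (\<lambda>_. F))" using F by (intro finite_PiE) auto
    show "cell ` X \<subseteq> PiE {..<D} (\<lambda>_. F)" unfolding F_def by (force simp: cell_def)
  qed (intro prod_nonneg w)
  also have "\<dots> = (\<Prod>j<D. \<Sum>\<kappa>\<in>F. w \<kappa>)"
    using F by (subst prod_sum_PiE) auto
  also have "\<dots> \<le> (\<Prod>j<D. W * 5)"
  proof (intro prod_mono conjI sum_nonneg w)
    show "(\<Sum>\<kappa>\<in>F. w \<kappa>) \<le> W * 5"
      unfolding w_def sum_distrib_left[symmetric]
      by (intro mult_left_mono sum_inverse_one_plus_square_le F W)
  qed
  finally show ?thesis by (simp add: W_def mult.commute)
qed

lemma norm_prod_squared: "(norm (\<Prod>i\<in>I. f i :: complex))\<^sup>2 = (\<Prod>i\<in>I. (norm (f i))\<^sup>2)"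
  by (simp add: prod_power_distrib flip: prod_norm)

lemma expi_box_sum:
  fixes D :: nat
  shows "(\<Sum>u\<in>PiE {..<D} (\<lambda>j. {..<N j}). expi (\<Sum>j<D. real (u j) * t j)) =
   (\<Prod>j<D. \<Sum>u<N j. expi (real u * t j))"
  by (subst prod_sum_PiE) (auto simp: expi_sum)

text \<open>A bound of the right order of magnitude, \<open>P^D / \<Prod> M\<^sub>i\<close> as soon as \<open>r\<close> is at least a constant times
  \<open>1/P\<close>, for the number of integer vectors \<open>y\<close> with entries up to \<open>P\<close> whose image under \<open>\<alpha>\<close> is within \<open>1/(8 M\<^sub>i)\<close> of an
  integer in each coordinate \<open>i\<close> with \<open>M\<^sub>i > 1\<close>. The exponential sum over \<open>\<xi>\<close> in the box with sides \<open>M\<^sub>i\<close> has absolute value at least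
  \<open>\<Prod> M\<^sub>i/2\<close> at each counted \<open>y\<close>, and each \<open>y\<close> is a difference \<open>u - u'\<close> of points of \<open>[0, 3P)^D\<close> in at
  least \<open>P^D\<close> ways. Duality turns the mean square over \<open>u, u'\<close> into sums over the separated points.\<close>

lemma count_near_integer_points:
  fixes \<alpha> :: "nat \<Rightarrow> nat \<Rightarrow> real" and M :: "nat \<Rightarrow> nat" and r :: real and S :: "(nat \<Rightarrow> int) set"
  assumes "r > 0"
    and sep: "\<And>\<xi> :: nat \<Rightarrow> int. \<exists>i<k. \<xi> i \<noteq> 0 \<Longrightarrow> \<forall>i<k. \<bar>\<xi> i\<bar> < int (M i) \<Longrightarrow>
      \<exists>j<D. r \<le> nint_dist (\<Sum>i<k. real_of_int (\<xi> i) * \<alpha> i j)"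
    and S: "finite S" "S \<subseteq> extensional {..<D}"
    and S_box: "\<And>y j. y \<in> S \<Longrightarrow> j < D \<Longrightarrow> \<bar>y j\<bar> \<le> int P"
    and S_near: "\<And>y i. y \<in> S \<Longrightarrow> i < k \<Longrightarrow>
      M i = 1 \<or> real (M i) * nint_dist (\<Sum>j<D. \<alpha> i j * real_of_int (y j)) \<le> 1 / 8"
    and M: "\<And>i. i < k \<Longrightarrow> M i > 0"
  shows "real (card S) * real P ^ D * (\<Prod>i<k. real (M i)) \<le>
     4 ^ k * (5 * (2 * real (3 * P) ^ 2 + 8 / r ^ 2)) ^ D"
proof -
  define X where "X = PiE {..<k} (\<lambda>i. {..<M i})"
  define U where "U = PiE {..<D} (\<lambda>j::nat. {..<3 * P})"
  define V where "V = PiE {..<D} (\<lambda>j::nat. {P..<2 * P})"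
  define B where "B = (\<lambda>(x::nat\<Rightarrow>nat) (u::nat\<Rightarrow>nat). \<Sum>i<k. \<Sum>j<D. real (x i) * \<alpha> i j * real (u j))"
  define Mp where "Mp = (\<Prod>i<k. real (M i))"
  define R where "R = (5 * (2 * real (3 * P) ^ 2 + 8 / r ^ 2)) ^ D"
  have fin: "finite X" "finite U" "finite V"
    unfolding X_def U_def V_def by (auto intro!: finite_PiE)
  have cardV: "real (card V) = real P ^ D" by (simp add: V_def card_PiE)
  have cardX: "real (card X) = Mp" by (simp add: X_def card_PiE Mp_def)
  define h where "h = (\<lambda>u u'. (norm (\<Sum>x\<in>X. expi (B x u - B x u')))\<^sup>2)"
  \<comment> \<open>Each counted \<open>y\<close> is written as a difference with the subtrahend in the middle third \<open>[P, 2P)\<close>, so that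
    the minuend stays in \<open>[0, 3P)\<close>.\<close>
  define g where "g = (\<lambda>(u'::nat\<Rightarrow>nat, y::nat\<Rightarrow>int). (\<lambda>j\<in>{..<D}. nat (int (u' j) + y j), u'))"
  have h_lower: "Mp\<^sup>2 / 4 ^ k \<le> (case g p of (u, u') \<Rightarrow> h u u')" if "p \<in> V \<times> S" for p
  proof -
    obtain u' y where p: "p = (u', y)" "u' \<in> V" "y \<in> S" using \<open>p \<in> V \<times> S\<close> by auto
    define u where "u = (\<lambda>j\<in>{..<D}. nat (int (u' j) + y j))"
    have u: "real (u j) - real (u' j) = real_of_int (y j)" if "j < D" for j
    proof -
      have "u' j \<in> {P..<2 * P}" using PiE_mem[OF p(2)[unfolded V_def], of j] that by simp
      then have "int (u' j) + y j \<ge> 0" using S_box[OF p(3) that] by auto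
      then show ?thesis using that by (simp add: u_def)
    qed
    define \<beta> where "\<beta> = (\<lambda>i. \<Sum>j<D. \<alpha> i j * real_of_int (y j))"
    have "B x u - B x u' = (\<Sum>i<k. real (x i) * \<beta> i)" for x
      unfolding B_def \<beta>_def sum_subtractf[symmetric] sum_distrib_left
      by (intro sum.cong refl) (auto simp: u[symmetric] algebra_simps)
    then have "h u u' = (norm (\<Prod>i<k. \<Sum>x<M i. expi (real x * \<beta> i)))\<^sup>2"
      unfolding h_def X_def by (simp add: expi_box_sum)
    then have hu: "h u u' = (\<Prod>i<k. (norm (\<Sum>x<M i. expi (real x * \<beta> i)))\<^sup>2)"
      by (simp only: norm_prod_squared)
    have "Mp\<^sup>2 / 4 ^ k = (\<Prod>i<k. (real (M i) / 2)\<^sup>2)"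
      by (simp add: Mp_def power_divide prod_dividef prod_power_distrib)
    also have "\<dots> \<le> h u u'" unfolding hu
    proof (intro prod_mono conjI power_mono)
      fix i assume "i \<in> {..<k}"
      then show "real (M i) / 2 \<le> norm (\<Sum>x<M i. expi (real x * \<beta> i))"
        using S_near[OF p(3), of i] unfolding \<beta>_def by (intro expi_partial_sum_ge) auto
    qed auto
    finally show ?thesis by (simp add: p g_def u_def[symmetric])
  qed
  have g_inj: "inj_on g (V \<times> S)"
  proof (rule inj_onI)
    fix p p' assume p: "p \<in> V \<times> S" "p' \<in> V \<times> S" "g p = g p'"
    obtain u y u' y' where q: "p = (u, y)" "p' = (u', y')" by (metis surj_pair)
    have uu: "u = u'" using p(3) q by (simp add: g_def)
    have "y j = y' j" if "j < D" for j
    proof -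
      have "u \<in> PiE {..<D} (\<lambda>j. {P..<2 * P})" using p(1) q by (simp add: V_def)
      then have "u j \<in> {P..<2 * P}" by (rule PiE_mem) (use that in simp)
      then have "int (u j) + y j \<ge> 0" "int (u j) + y' j \<ge> 0"
        using S_box[of y j] S_box[of y' j] p q that by auto
      moreover have "nat (int (u j) + y j) = nat (int (u j) + y' j)"
        using p(3) q that uu by (auto simp: g_def fun_eq_iff restrict_def split: if_splits)
      ultimately show ?thesis by simp
    qed
    moreover have "y \<in> extensional {..<D}" "y' \<in> extensional {..<D}"
      using p(1,2) q S(2) by blast+
    ultimately have "y = y'" by (metis extensionalityI lessThan_iff)
    then show "p = p'" using uu q by simp
  qed
  have g_range: "g ` (V \<times> S) \<subseteq> U \<times> U"
  proof (clarsimp simp: g_def)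
    fix u y assume u: "u \<in> V" "y \<in> S"
    have *: "P \<le> u j" "u j < 2 * P" "\<bar>y j\<bar> \<le> int P" if "j < D" for j
      using u that S_box[OF u(2) that] by (auto simp: V_def PiE_def Pi_def)
    have "u \<in> U" using u(1) * by (fastforce simp: U_def V_def PiE_def Pi_def)
    moreover have "(\<lambda>j\<in>{..<D}. nat (int (u j) + y j)) \<in> U"
      unfolding U_def
    proof (intro restrict_PiE_iff[THEN iffD2] ballI)
      fix j assume "j \<in> {..<D}"
      then show "nat (int (u j) + y j) \<in> {..<3 * P}" using *[of j] by auto
    qed
    ultimately show "(\<lambda>j\<in>{..<D}. nat (int (u j) + y j)) \<in> U \<and> u \<in> U" by simp
  qed
  have "real (card S) * real P ^ D * (Mp\<^sup>2 / 4 ^ k) = (\<Sum>p\<in>V \<times> S. Mp\<^sup>2 / 4 ^ k)"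
    using S(1) fin by (simp add: card_cartesian_product cardV)
  also have "\<dots> \<le> (\<Sum>p\<in>V \<times> S. case g p of (u, u') \<Rightarrow> h u u')"
    by (intro sum_mono h_lower)
  also have "\<dots> = (\<Sum>(u, u')\<in>g ` (V \<times> S). h u u')"
    using g_inj by (simp add: sum.reindex)
  also have "\<dots> \<le> (\<Sum>(u, u')\<in>U \<times> U. h u u')"
    using g_range fin by (intro sum_mono2) (auto simp: h_def)
  also have "\<dots> = (\<Sum>u\<in>U. \<Sum>u'\<in>U. h u u')"
    by (simp add: sum.cartesian_product)
  also have "\<dots> = (\<Sum>x\<in>X. \<Sum>x'\<in>X. (norm (\<Sum>u\<in>U. expi (B x u - B x' u)))\<^sup>2)"
    unfolding h_def by (rule expi_duality[OF fin(2,1)])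
  also have "\<dots> \<le> (\<Sum>x\<in>X. R)"
  proof (rule sum_mono)
    fix x assume x: "x \<in> X"
    define \<theta> where "\<theta> = (\<lambda>x' j. \<Sum>i<k. (real (x i) - real (x' i)) * \<alpha> i j)"
    have "B x u - B x' u = (\<Sum>j<D. real (u j) * \<theta> x' j)" for x' u
      unfolding B_def \<theta>_def sum_subtractf[symmetric] sum_distrib_left
      by (subst sum.swap) (intro sum.cong refl, simp add: algebra_simps)
    then have "(\<Sum>x'\<in>X. (norm (\<Sum>u\<in>U. expi (B x u - B x' u)))\<^sup>2) =
        (\<Sum>x'\<in>X. \<Prod>j<D. norm (\<Sum>u<3 * P. expi (real u * \<theta> x' j)) ^ 2)"
      unfolding U_def by (simp add: expi_box_sum norm_prod_squared)
    also have "\<dots> \<le> R" unfolding R_def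
    proof (rule separated_expi_sum_bound)
      fix y z assume yz: "y \<in> X" "z \<in> X" "y \<noteq> z"
      let ?\<xi> = "\<lambda>i. int (z i) - int (y i)"
      have "\<exists>i<k. ?\<xi> i \<noteq> 0"
      proof (rule ccontr)
        assume "\<not> (\<exists>i<k. ?\<xi> i \<noteq> 0)"
        then have "y = z" using yz(1,2) unfolding X_def by (intro PiE_ext[of y "{..<k}" _ z]) simp_all
        then show False using yz by simp
      qed
      moreover have "\<forall>i<k. \<bar>?\<xi> i\<bar> < int (M i)"
      proof (intro allI impI)
        fix i assume "i < k"
        then have "y i < M i" "z i < M i" using PiE_mem[OF yz(1)[unfolded X_def], of i] PiE_mem[OF yz(2)[unfolded X_def], of i] by simp_all
        then show "\<bar>?\<xi> i\<bar> < int (M i)" by linarith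
      qed
      ultimately have "\<exists>j<D. r \<le> nint_dist (\<Sum>i<k. real_of_int (?\<xi> i) * \<alpha> i j)"
        by (rule sep)
      then obtain j where j: "j < D" "r \<le> nint_dist (\<Sum>i<k. real_of_int (?\<xi> i) * \<alpha> i j)"
        by blast
      moreover have "\<theta> y j - \<theta> z j = (\<Sum>i<k. real_of_int (?\<xi> i) * \<alpha> i j)"
        unfolding \<theta>_def sum_subtractf[symmetric] by (intro sum.cong refl) (simp add: algebra_simps)
      ultimately show "\<exists>j<D. r \<le> nint_dist (\<theta> y j - \<theta> z j)" by metis
    qed (rule fin, rule assms)
    finally show "(\<Sum>x'\<in>X. (norm (\<Sum>u\<in>U. expi (B x u - B x' u)))\<^sup>2) \<le> R" .
  qed
  finally have "real (card S) * real P ^ D * (Mp\<^sup>2 / 4 ^ k) \<le> Mp * R" by (simp add: cardX)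
  then have "Mp * (real (card S) * real P ^ D * Mp) \<le> Mp * (4 ^ k * R)"
    by (simp add: field_simps power2_eq_square)
  moreover have "Mp > 0" unfolding Mp_def using M by (intro prod_pos) auto
  ultimately show ?thesis unfolding Mp_def[symmetric] R_def[symmetric] by simp
qed

section \<open>Lebesgue measure on an affine subspace\<close>

lemma distr_PiM_lborel_translation:
  fixes c :: "nat \<Rightarrow> real" and d :: nat
  defines "N \<equiv> Pi\<^sub>M {..<d} (\<lambda>_. lborel :: real measure)"
  shows "distr N N (\<lambda>t. \<lambda>i\<in>{..<d}. c i + t i) = N"
proof -
  interpret product_sigma_finite "\<lambda>_::nat. lborel :: real measure" by standard
  let ?f = "\<lambda>t. \<lambda>i\<in>{..<d}. c i + t i"
  have f [measurable]: "?f \<in> measurable N N" unfolding N_def by measurable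
  show ?thesis
    unfolding N_def
  proof (rule PiM_eqI)
    fix A :: "nat \<Rightarrow> real set" assume A: "\<And>i. i \<in> {..<d} \<Longrightarrow> A i \<in> sets lborel"
    have pre: "(+) (c i) -` A i \<in> sets lborel" if "i < d" for i
      using measurable_sets[of "(+) (c i)" lborel lborel "A i"] A[of i] that by simp
    have "?f -` Pi\<^sub>E {..<d} A \<inter> space N = (\<Pi>\<^sub>E i\<in>{..<d}. (+) (c i) -` A i)"
      unfolding N_def by (auto simp: space_PiM PiE_iff)
    then have "emeasure (distr N N ?f) (Pi\<^sub>E {..<d} A) = emeasure N (\<Pi>\<^sub>E i\<in>{..<d}. (+) (c i) -` A i)"
      using A by (subst emeasure_distr[OF f]) (auto simp: N_def)
    also have "\<dots> = (\<Prod>i<d. emeasure lborel ((+) (c i) -` A i))"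
      unfolding N_def using pre by (subst emeasure_PiM) auto
    also have "\<dots> = (\<Prod>i<d. emeasure lborel (A i))"
    proof (rule prod.cong[OF refl])
      fix i assume i: "i \<in> {..<d}"
      have "emeasure lborel (A i) = emeasure (distr lborel borel ((+) (c i))) (A i)"
        by (simp add: lborel_distr_plus)
      also have "\<dots> = emeasure lborel ((+) (c i) -` A i)"
        using A[OF i] by (subst emeasure_distr) auto
      finally show "emeasure lborel ((+) (c i) -` A i) = emeasure lborel (A i)" by simp
    qed
    finally show "emeasure (distr (Pi\<^sub>M {..<d} (\<lambda>_. lborel)) (Pi\<^sub>M {..<d} (\<lambda>_. lborel)) ?f) (Pi\<^sub>E {..<d} A) =
        (\<Prod>i<d. emeasure lborel (A i))" by (simp add: N_def)
  qed simp_all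
qed

text \<open>The properties of the Lebesgue measure on \<open>L\<close> on which all later estimates rest; in particular its
  density with respect to a Monge parametrisation is never computed.\<close>

definition flat_measure :: "(real ^ 'n) set \<Rightarrow> (real ^ 'n) measure \<Rightarrow> bool" where
  "flat_measure L \<mu> \<longleftrightarrow> sets \<mu> = sets borel \<and> L \<in> sets borel \<and> emeasure \<mu> (- L) = 0 \<and>
     (\<forall>x\<in>L. \<forall>y\<in>L. distr \<mu> borel ((+) (y - x)) = \<mu>) \<and> (\<forall>R. emeasure \<mu> (cball 0 R) < \<infinity>)"

text \<open>In the coordinates of an orthonormal frame, a translation of \<open>L\<close> along itself becomes a translation of
  \<open>d\<close>-dimensional space, and the coordinates are bounded on bounded subsets of \<open>L\<close>.\<close>

lemma flat_measure_induced_lebesgue: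
  fixes L :: "(real ^ 'n) set"
  assumes "affine L" "aff_dim L = int d"
  shows "flat_measure L (induced_lebesgue d L)"
proof -
  define q where "q = (SOME (p, u). orthonormal_frame d L p u)"
  obtain p u where q: "q = (p, u)" by (rule prod.exhaust)
  have "\<exists>x. case x of (p, u) \<Rightarrow> orthonormal_frame d L p u"
    using ex_orthonormal_frame[OF assms] by auto
  then have "case q of (p, u) \<Rightarrow> orthonormal_frame d L p u"
    unfolding q_def by (rule someI_ex)
  then have frame: "orthonormal_frame d L p u" by (simp add: q)
  define N where "N = Pi\<^sub>M {..<d} (\<lambda>_. lborel :: real measure)"
  define \<phi> where "\<phi> = (\<lambda>t::nat \<Rightarrow> real. p + (\<Sum>i<d. t i *\<^sub>R u i))"
  have \<mu>: "induced_lebesgue d L = distr N borel \<phi>"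
    unfolding induced_lebesgue_def q_def[symmetric] q N_def \<phi>_def by simp
  have \<phi> [measurable]: "\<phi> \<in> borel_measurable N"
  proof -
    have "(\<lambda>t. t i) \<in> borel_measurable N" if "i < d" for i
      using measurable_component_singleton[of i "{..<d}" "\<lambda>_. lborel"] that by (simp add: N_def)
    then show ?thesis unfolding \<phi>_def by (intro borel_measurable_add borel_measurable_sum) auto
  qed
  have L: "L = range \<phi>" using frame by (simp add: orthonormal_frame_def \<phi>_def)
  have Lb: "L \<in> sets borel" using assms(1) by (simp add: affine_closed borel_closed)
  have "emeasure (distr N borel \<phi>) (- L) = 0"
  proof -
    have "\<phi> -` (- L) = {}" using L by auto
    then show ?thesis using Lb by (subst emeasure_distr) auto
  qed
  moreover have "distr (distr N borel \<phi>) borel ((+) (y - x)) = distr N borel \<phi>" if "x \<in> L" "y \<in> L" for x y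
  proof -
    obtain s t where st: "x = \<phi> s" "y = \<phi> t" using \<open>x \<in> L\<close> \<open>y \<in> L\<close> L by auto
    define c where "c = (\<lambda>i. t i - s i)"
    have eq: "y - x + \<phi> r = \<phi> (\<lambda>i\<in>{..<d}. c i + r i)" for r
      unfolding st \<phi>_def c_def
      by (simp add: sum_subtractf[symmetric] sum.distrib[symmetric] algebra_simps)
    have f [measurable]: "(\<lambda>t. \<lambda>i\<in>{..<d}. c i + t i) \<in> measurable N N" unfolding N_def by measurable
    have "distr (distr N borel \<phi>) borel ((+) (y - x)) = distr N borel (\<phi> \<circ> (\<lambda>t. \<lambda>i\<in>{..<d}. c i + t i))"
      by (subst distr_distr) (auto simp: comp_def eq)
    also have "\<dots> = distr (distr N N (\<lambda>t. \<lambda>i\<in>{..<d}. c i + t i)) borel \<phi>"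
      by (subst distr_distr) auto
    also have "\<dots> = distr N borel \<phi>"
      unfolding N_def by (simp add: distr_PiM_lborel_translation)
    finally show ?thesis .
  qed
  moreover have "emeasure (distr N borel \<phi>) (cball 0 R) < \<infinity>" for R
  proof -
    interpret product_sigma_finite "\<lambda>_::nat. lborel :: real measure" by standard
    define K where "K = \<bar>R\<bar> + norm p"
    have "\<phi> -` cball 0 R \<inter> space N \<subseteq> (\<Pi>\<^sub>E i\<in>{..<d}. {-K..K})"
    proof
      fix t assume t: "t \<in> \<phi> -` cball 0 R \<inter> space N"
      have "t i \<in> {-K..K}" if i: "i < d" for i
      proof -
        have "(\<phi> t - p) \<bullet> u i = (\<Sum>j<d. t j * (u j \<bullet> u i))"
          by (simp add: \<phi>_def inner_sum_left)
        also have "\<dots> = (\<Sum>j<d. if j = i then t j else 0)"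
          using frame i by (intro sum.cong refl) (auto simp: orthonormal_frame_def)
        also have "\<dots> = t i" using i by simp
        finally have ti: "t i = (\<phi> t - p) \<bullet> u i" by simp
        have "u i \<bullet> u i = 1" using frame i by (simp add: orthonormal_frame_def)
        then have "norm (u i) = 1" by (simp add: norm_eq_sqrt_inner)
        then have "\<bar>t i\<bar> \<le> norm (\<phi> t - p)" unfolding ti using Cauchy_Schwarz_ineq2[of "\<phi> t - p" "u i"] by simp
        also have "\<dots> \<le> norm (\<phi> t) + norm p" by (rule norm_triangle_ineq4)
        also have "\<dots> \<le> K" using t by (auto simp: K_def)
        finally show ?thesis by auto
      qed
      then show "t \<in> (\<Pi>\<^sub>E i\<in>{..<d}. {-K..K})" using t by (auto simp: N_def space_PiM PiE_iff)
    qed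
    then have "emeasure N (\<phi> -` cball 0 R \<inter> space N) \<le> emeasure N (\<Pi>\<^sub>E i\<in>{..<d}. {-K..K})"
      unfolding N_def by (intro emeasure_mono sets_PiM_I_finite) auto
    also have "\<dots> = (\<Prod>i<d. emeasure lborel {-K..K})"
      unfolding N_def by (subst emeasure_PiM) auto
    also have "\<dots> < \<infinity>" by (simp add: K_def ennreal_power less_top[symmetric] ennreal_mult_eq_top_iff power_eq_top_ennreal)
    finally show ?thesis by (subst emeasure_distr) auto
  qed
  ultimately show ?thesis unfolding flat_measure_def \<mu> using Lb by simp
qed

text \<open>Lift the unit vectors and the origin of the coordinate subspace to points of \<open>L\<close>. The differences
  of these points are \<open>d\<close> independent directions, hence span the direction space of \<open>L\<close>; their remaining
  coordinates are the columns of \<open>A\<close>.\<close>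

lemma ex_monge_parametrisation:
  fixes L :: "(real ^ 'n) set"
  assumes L: "affine L" "aff_dim L = int d" and d: "d < CARD('n)"
    and surj: "surjective_projections d L" and e: "bij_betw e {..<CARD('n)} UNIV"
  shows "\<exists>A b. monge_parametrisation d L e A b"
proof -
  define I where "I = e ` {..<d}"
  have inj: "inj_on e {..<CARD('n)}" using e by (simp add: bij_betw_def)
  have ee: "e i = e j \<longleftrightarrow> i = j" if "i < CARD('n)" "j < CARD('n)" for i j
    using inj that by (auto simp: inj_on_def)
  have "card I = d"
    unfolding I_def using inj_on_subset[OF inj, of "{..<d}"] d by (simp add: card_image)
  then have pr: "coord_proj I ` L = coord_subspace I" using surj by (simp add: surjective_projections_def)
  have lift: "\<exists>x\<in>L. \<forall>j<d. x $ e j = t j" for t :: "nat \<Rightarrow> real"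
  proof -
    define y :: "real ^ 'n" where "y = (\<chi> i. if i \<in> I then t (inv_into {..<CARD('n)} e i) else 0)"
    have "y \<in> coord_subspace I" by (simp add: coord_subspace_def y_def)
    then obtain x where x: "x \<in> L" "y = coord_proj I x" using pr by auto
    have "x $ e j = t j" if "j < d" for j
    proof -
      have "e j \<in> I" using that by (simp add: I_def)
      then have "x $ e j = y $ e j" by (simp add: x coord_proj_def)
      also have "\<dots> = t j" using \<open>e j \<in> I\<close> that d inj by (simp add: y_def)
      finally show ?thesis .
    qed
    then show ?thesis using x by blast
  qed
  obtain p where p: "p \<in> L" "\<And>j. j < d \<Longrightarrow> p $ e j = 0" using lift[of "\<lambda>_. 0"] by auto
  have "\<exists>x. \<forall>k<d. x k \<in> L \<and> (\<forall>j<d. x k $ e j = (if j = k then 1 else 0))"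
  proof -
    have "\<forall>k. \<exists>x\<in>L. \<forall>j<d. x $ e j = (if j = k then 1 else 0)"
      using lift[of "\<lambda>j. if j = _ then 1 else 0"] by blast
    then show ?thesis by metis
  qed
  then obtain x where x: "\<And>k. k < d \<Longrightarrow> x k \<in> L"
      "\<And>k j. k < d \<Longrightarrow> j < d \<Longrightarrow> x k $ e j = (if j = k then 1 else 0)"
    by blast
  define v where "v = (\<lambda>k. x k - p)"
  have v: "v k $ e j = (if j = k then 1 else 0)" if "k < d" "j < d" for k j
    using x(2)[OF that] p(2)[OF that(2)] by (simp add: v_def)
  define V where "V = (\<lambda>y. y - p) ` L"
  have sub: "subspace V"
    unfolding V_def using affine_diffs_subspace_subtract[OF L(1) p(1)] by (simp add: image_def)
  have dimV: "dim V = d"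
  proof -
    have "aff_dim V = aff_dim L"
      unfolding V_def using aff_dim_translation_eq[of "- p" L] by (simp add: algebra_simps)
    then show ?thesis using aff_dim_subspace[OF sub] L(2) by simp
  qed
  have vinj: "inj_on v {..<d}"
    by (rule inj_onI) (metis lessThan_iff v zero_neq_one)
  have sumv: "(\<Sum>k<d. t k *\<^sub>R v k) $ e j = t j" if "j < d" for t j
  proof -
    have "(\<Sum>k<d. t k *\<^sub>R v k) $ e j = (\<Sum>k<d. t k * v k $ e j)" by (simp add: sum_component)
    also have "\<dots> = (\<Sum>k<d. if k = j then t k else 0)"
      by (rule sum.cong[OF refl]) (use v that in auto)
    finally show ?thesis using that by simp
  qed
  have "independent (v ` {..<d})"
  proof (rule real_vector.independent_if_scalars_zero)
    fix f w assume f: "(\<Sum>w\<in>v ` {..<d}. f w *\<^sub>R w) = 0" "w \<in> v ` {..<d}"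
    then obtain j where j: "j < d" "w = v j" by auto
    have "0 = (\<Sum>k<d. f (v k) *\<^sub>R v k)" using f(1) by (simp add: sum.reindex[OF vinj])
    then have "0 = (\<Sum>k<d. f (v k) *\<^sub>R v k) $ e j" by (metis zero_index)
    then show "f w = 0" using sumv[OF j(1), of "\<lambda>k. f (v k)"] j by simp
  qed simp
  moreover have vV: "v ` {..<d} \<subseteq> V" unfolding V_def v_def using x(1) by auto
  ultimately have "V \<subseteq> span (v ` {..<d})"
    by (intro card_ge_dim_independent) (simp_all add: card_image[OF vinj] dimV)
  then have Vspan: "V = span (v ` {..<d})"
    using vV sub by (meson span_minimal subset_antisym)
  have "span (v ` {..<d}) = range (\<lambda>t. \<Sum>k<d. t k *\<^sub>R v k)"
  proof -
    have "span (v ` {..<d}) = range (\<lambda>f. \<Sum>k<d. f (v k) *\<^sub>R v k)"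
      by (simp add: span_finite sum.reindex[OF vinj])
    also have "\<dots> = range (\<lambda>t. \<Sum>k<d. t k *\<^sub>R v k)"
    proof (intro equalityI subsetI)
      fix y assume "y \<in> range (\<lambda>t. \<Sum>k<d. t k *\<^sub>R v k)"
      then obtain t where "y = (\<Sum>k<d. t k *\<^sub>R v k)" by blast
      also have "\<dots> = (\<Sum>k<d. t (inv_into {..<d} v (v k)) *\<^sub>R v k)"
        using vinj by (intro sum.cong refl) (simp add: inv_into_f_f)
      finally show "y \<in> range (\<lambda>f. \<Sum>k<d. f (v k) *\<^sub>R v k)"
        by (intro range_eqI[of _ _ "\<lambda>w. t (inv_into {..<d} v w)"]) simp
    next
      fix y assume "y \<in> range (\<lambda>f. \<Sum>k<d. f (v k) *\<^sub>R v k)"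
      then obtain f where "y = (\<Sum>k<d. f (v k) *\<^sub>R v k)" by blast
      then show "y \<in> range (\<lambda>t. \<Sum>k<d. t k *\<^sub>R v k)"
        by (intro range_eqI[of _ _ "\<lambda>k. f (v k)"]) simp
    qed
    finally show ?thesis .
  qed
  then have LV: "y \<in> L \<longleftrightarrow> (\<exists>t. y = p + (\<Sum>k<d. t k *\<^sub>R v k))" for y
  proof -
    have "y \<in> L \<longleftrightarrow> y - p \<in> V" unfolding V_def by force
    also have "\<dots> \<longleftrightarrow> (\<exists>t. y - p = (\<Sum>k<d. t k *\<^sub>R v k))"
      using Vspan \<open>span (v ` {..<d}) = range (\<lambda>t. \<Sum>k<d. t k *\<^sub>R v k)\<close> by auto
    finally show ?thesis by (simp add: algebra_simps)
  qed
  define A where "A = (\<lambda>i j. v j $ e (d + i))"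
  define b where "b = (\<lambda>i. p $ e (d + i))"
  have "monge_parametrisation d L e A b"
    unfolding monge_parametrisation_def
  proof (intro conjI e set_eqI iffI)
    fix y assume "y \<in> L"
    then obtain t where y: "y = p + (\<Sum>k<d. t k *\<^sub>R v k)" using LV by blast
    then have "\<forall>j<d. y $ e j = t j" using sumv p(2) by simp
    moreover have "\<forall>i<CARD('n) - d. y $ e (d + i) = (\<Sum>j<d. A i j * t j) + b i"
      by (simp add: y A_def b_def sum_component mult.commute)
    ultimately show "y \<in> {x. \<exists>t. (\<forall>j<d. x $ e j = t j) \<and>
       (\<forall>i<CARD('n) - d. x $ e (d + i) = (\<Sum>j<d. A i j * t j) + b i)}" by blast
  next
    fix y assume "y \<in> {x. \<exists>t. (\<forall>j<d. x $ e j = t j) \<and>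
       (\<forall>i<CARD('n) - d. x $ e (d + i) = (\<Sum>j<d. A i j * t j) + b i)}"
    then obtain t where t: "\<And>j. j < d \<Longrightarrow> y $ e j = t j"
      "\<And>i. i < CARD('n) - d \<Longrightarrow> y $ e (d + i) = (\<Sum>j<d. A i j * t j) + b i" by blast
    have "y = p + (\<Sum>k<d. t k *\<^sub>R v k)"
    proof (rule vec_eq_iff[THEN iffD2], rule allI)
      fix i
      obtain m where m: "m < CARD('n)" "i = e m" using e by (metis UNIV_I bij_betw_def image_iff lessThan_iff)
      show "y $ i = (p + (\<Sum>k<d. t k *\<^sub>R v k)) $ i"
      proof (cases "m < d")
        case True
        then show ?thesis using t(1) sumv p(2) m by simp
      next
        case False
        then obtain l where l: "m = d + l" "l < CARD('n) - d" using m d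
          by (metis add_diff_inverse_nat diff_less_mono not_less)
        then show ?thesis using t(2) m by (simp add: A_def b_def sum_component mult.commute)
      qed
    qed
    then show "y \<in> L" using LV by blast
  qed
  then show ?thesis by blast
qed

text \<open>Instead of a Jacobian, a packing argument: \<open>L\<close> can be translated along itself so as to move the
  first \<open>d\<close> coordinates arbitrarily, hence all slabs with the same side lengths have the same measure. At least
  \<open>\<Prod> 1/(2 \<eta>\<^sub>j)\<close> disjoint ones fit into the unit slab, whose intersection with \<open>L\<close> is bounded.\<close>

lemma monge_slab_measure:
  fixes L :: "(real ^ 'n) set"
  assumes \<mu>: "flat_measure L \<mu>" and mon: "monge_parametrisation d L e A b" and d: "d < CARD('n)"
  shows "\<exists>C\<ge>0. \<forall>c \<eta>. (\<forall>j<d. 0 < \<eta> j \<and> \<eta> j \<le> 1) \<longrightarrow>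
     emeasure \<mu> {x. \<forall>j<d. c j \<le> x $ e j \<and> x $ e j < c j + \<eta> j} \<le> ennreal (C * (\<Prod>j<d. \<eta> j))"
proof -
  have e: "bij_betw e {..<CARD('n)} UNIV" using mon by (simp add: monge_parametrisation_def)
  have inj: "inj_on e {..<CARD('n)}" using e by (simp add: bij_betw_def)
  have sets [simp]: "sets \<mu> = sets borel" and null: "emeasure \<mu> (- L) = 0" and Lb: "L \<in> sets borel"
    and tr: "\<And>x y. x \<in> L \<Longrightarrow> y \<in> L \<Longrightarrow> distr \<mu> borel ((+) (y - x)) = \<mu>"
    and fin: "\<And>R. emeasure \<mu> (cball 0 R) < \<infinity>"
    using \<mu> by (auto simp: flat_measure_def)
  have space [simp]: "space \<mu> = UNIV" using sets_eq_imp_space_eq[OF sets] by simp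
  have Lmem: "x \<in> L \<longleftrightarrow> (\<forall>i<CARD('n) - d. x $ e (d + i) = (\<Sum>j<d. A i j * x $ e j) + b i)" for x
    using mon unfolding monge_parametrisation_def by auto
  define pt where "pt = (\<lambda>\<tau>::nat \<Rightarrow> real. \<chi> i. let m = inv_into {..<CARD('n)} e i in
      if m < d then \<tau> m else (\<Sum>j<d. A (m - d) j * \<tau> j) + b (m - d))"
  have pt1: "pt \<tau> $ e j = \<tau> j" if "j < d" for \<tau> j
    using that d inj by (simp add: pt_def)
  have ptL: "pt \<tau> \<in> L" for \<tau>
    unfolding Lmem using pt1 inj by (auto simp: pt_def)
  define B where "B = (\<lambda>(c::nat \<Rightarrow> real) (\<eta>::nat \<Rightarrow> real). {x. \<forall>j<d. c j \<le> x $ e j \<and> x $ e j < c j + \<eta> j})"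
  have Bb: "B c \<eta> \<in> sets borel" for c \<eta>
    unfolding B_def by measurable
  have trB: "emeasure \<mu> (B c \<eta>) = emeasure \<mu> (B (\<lambda>_. 0) \<eta>)" for c \<eta>
  proof -
    have "emeasure \<mu> (B c \<eta>) = emeasure (distr \<mu> borel ((+) (pt c - pt (\<lambda>_. 0)))) (B c \<eta>)"
      by (simp add: tr ptL)
    also have "\<dots> = emeasure \<mu> ((+) (pt c - pt (\<lambda>_. 0)) -` B c \<eta>)"
      using Bb measurable_cong_sets[OF sets refl, of borel] by (subst emeasure_distr) auto
    also have "(+) (pt c - pt (\<lambda>_. 0)) -` B c \<eta> = B (\<lambda>_. 0) \<eta>"
      by (auto simp: B_def pt1)
    finally show ?thesis .
  qed
  define K where "K = 1 + (\<Sum>i<CARD('n) - d. (\<Sum>j<d. \<bar>A i j\<bar>) + \<bar>b i\<bar>)"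
  have B1: "B (\<lambda>_. 0) (\<lambda>_. 1) \<inter> L \<subseteq> cball 0 (real CARD('n) * K)"
  proof
    fix x assume x: "x \<in> B (\<lambda>_. 0) (\<lambda>_. 1) \<inter> L"
    have K1: "1 \<le> K" unfolding K_def by (simp add: sum_nonneg)
    have xi: "\<bar>x $ i\<bar> \<le> K" for i
    proof -
      obtain m where m: "m < CARD('n)" "i = e m" using e by (metis UNIV_I bij_betw_def image_iff lessThan_iff)
      have xj: "\<bar>x $ e j\<bar> \<le> 1" if "j < d" for j using x that by (auto simp: B_def)
      show ?thesis
      proof (cases "m < d")
        case True
        then show ?thesis using xj m K1 by fastforce
      next
        case False
        then obtain l where l: "m = d + l" "l < CARD('n) - d" using m d
          by (metis add_diff_inverse_nat diff_less_mono not_less)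
        have "\<bar>x $ i\<bar> = \<bar>(\<Sum>j<d. A l j * x $ e j) + b l\<bar>" using x l m by (simp add: Lmem)
        also have "\<dots> \<le> \<bar>\<Sum>j<d. A l j * x $ e j\<bar> + \<bar>b l\<bar>" by (rule abs_triangle_ineq)
        also have "\<bar>\<Sum>j<d. A l j * x $ e j\<bar> \<le> (\<Sum>j<d. \<bar>A l j * x $ e j\<bar>)" by (rule sum_abs)
        also have "\<dots> \<le> (\<Sum>j<d. \<bar>A l j\<bar>)"
          using xj by (intro sum_mono) (auto simp: abs_mult intro!: mult_left_le)
        also have "(\<Sum>j<d. \<bar>A l j\<bar>) + \<bar>b l\<bar> \<le> (\<Sum>i<CARD('n) - d. (\<Sum>j<d. \<bar>A i j\<bar>) + \<bar>b i\<bar>)"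
          using l by (intro member_le_sum) (auto intro!: add_nonneg_nonneg sum_nonneg)
        finally show ?thesis by (simp add: K_def)
      qed
    qed
    have "norm x \<le> (\<Sum>i\<in>UNIV. \<bar>x $ i\<bar>)" by (rule norm_le_l1_cart)
    also have "\<dots> \<le> (\<Sum>i\<in>(UNIV :: 'n set). K)" by (intro sum_mono xi)
    finally show "x \<in> cball 0 (real CARD('n) * K)" by simp
  qed
  define K0 where "K0 = measure \<mu> (B (\<lambda>_. 0) (\<lambda>_. 1))"
  have finB1: "emeasure \<mu> (B (\<lambda>_. 0) (\<lambda>_. 1)) < \<infinity>"
  proof -
    have "emeasure \<mu> (B (\<lambda>_. 0) (\<lambda>_. 1)) \<le> emeasure \<mu> (cball 0 (real CARD('n) * K) \<union> - L)"
      using B1 Lb by (intro emeasure_mono) auto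
    also have "\<dots> \<le> emeasure \<mu> (cball 0 (real CARD('n) * K)) + emeasure \<mu> (- L)"
      using Lb by (intro emeasure_subadditive) auto
    also have "\<dots> < \<infinity>" using fin null by simp
    finally show ?thesis .
  qed
  have K0: "emeasure \<mu> (B (\<lambda>_. 0) (\<lambda>_. 1)) = ennreal K0"
    unfolding K0_def using finB1 by (intro emeasure_eq_ennreal_measure) simp
  have main: "emeasure \<mu> (B c \<eta>) \<le> ennreal (2 ^ d * K0 * (\<Prod>j<d. \<eta> j))"
    if \<eta>: "\<forall>j<d. 0 < \<eta> j \<and> \<eta> j \<le> 1" for c \<eta>
  proof -
    define m where "m = (\<lambda>j. nat \<lfloor>1 / \<eta> j\<rfloor>)"
    have m: "real (m j) * \<eta> j \<le> 1" "1 \<le> 2 * real (m j) * \<eta> j" if "j < d" for j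
    proof -
      have h: "0 < \<eta> j" "\<eta> j \<le> 1" using \<eta> that by auto
      then have "1 \<le> 1 / \<eta> j" by simp
      then have f: "1 \<le> \<lfloor>1 / \<eta> j\<rfloor>" by linarith
      then have r: "real (m j) = of_int \<lfloor>1 / \<eta> j\<rfloor>" unfolding m_def by linarith
      have "real (m j) \<le> 1 / \<eta> j" unfolding r by linarith
      then show "real (m j) * \<eta> j \<le> 1" using h by (simp add: pos_le_divide_eq)
      have "1 / \<eta> j \<le> 2 * real (m j)" unfolding r using f by linarith
      then show "1 \<le> 2 * real (m j) * \<eta> j" using h by (simp add: pos_divide_le_eq)
    qed
    define l where "l = PiE {..<d} (\<lambda>j. {..<m j})"
    define G where "G = (\<lambda>l::nat \<Rightarrow> nat. B (\<lambda>j. real (l j) * \<eta> j) \<eta>)"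
    have "disjoint_family_on G l"
      unfolding disjoint_family_on_def
    proof (intro ballI impI)
      fix s t assume st: "s \<in> l" "t \<in> l" "s \<noteq> t"
      show "G s \<inter> G t = {}"
      proof (rule ccontr)
        assume "G s \<inter> G t \<noteq> {}"
        then obtain x where x: "x \<in> G s" "x \<in> G t" by blast
        have "s j = t j" if j: "j < d" for j
        proof -
          have h: "0 < \<eta> j" using \<eta> j by auto
          have a: "real (s j) * \<eta> j \<le> x $ e j" "x $ e j < (real (s j) + 1) * \<eta> j"
              "real (t j) * \<eta> j \<le> x $ e j" "x $ e j < (real (t j) + 1) * \<eta> j"
            using x j by (auto simp: G_def B_def algebra_simps)
          then have "real (s j) * \<eta> j < (real (t j) + 1) * \<eta> j"
            "real (t j) * \<eta> j < (real (s j) + 1) * \<eta> j" by linarith+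
          then have "real (s j) < real (t j) + 1" "real (t j) < real (s j) + 1"
            using h by (simp_all add: mult_less_cancel_right)
          then show ?thesis by linarith
        qed
        then have "s = t" using st(1,2) unfolding l_def by (intro PiE_ext[of s "{..<d}" _ t]) simp_all
        then show False using st by simp
      qed
    qed
    moreover have "G ` l \<subseteq> sets \<mu>" using Bb by (auto simp: G_def)
    moreover have "finite l" unfolding l_def by (intro finite_PiE) auto
    ultimately have "(\<Sum>s\<in>l. emeasure \<mu> (G s)) = emeasure \<mu> (\<Union>s\<in>l. G s)"
      by (intro sum_emeasure)
    also have "\<dots> \<le> emeasure \<mu> (B (\<lambda>_. 0) (\<lambda>_. 1))"
    proof (rule emeasure_mono)
      show "(\<Union>s\<in>l. G s) \<subseteq> B (\<lambda>_. 0) (\<lambda>_. 1)"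
      proof (rule UN_least)
        fix s assume s: "s \<in> l"
        show "G s \<subseteq> B (\<lambda>_. 0) (\<lambda>_. 1)"
        proof
          fix x assume x: "x \<in> G s"
          have "0 \<le> x $ e j \<and> x $ e j < 1" if j: "j < d" for j
          proof -
            have h: "0 < \<eta> j" using \<eta> j by auto
            have "s j < m j" using PiE_mem[OF s[unfolded l_def], of j] j by simp
            then have "(real (s j) + 1) * \<eta> j \<le> real (m j) * \<eta> j" using h by (intro mult_right_mono) auto
            then have a: "(real (s j) + 1) * \<eta> j \<le> 1" using m[OF j] by linarith
            have b: "0 \<le> real (s j) * \<eta> j" using h by simp
            have "real (s j) * \<eta> j \<le> x $ e j" "x $ e j < (real (s j) + 1) * \<eta> j"
              using x j by (auto simp: G_def B_def algebra_simps)
            then show ?thesis using a b by linarith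
          qed
          then show "x \<in> B (\<lambda>_. 0) (\<lambda>_. 1)" by (simp add: B_def)
        qed
      qed
    qed (simp add: Bb)
    finally have "(\<Sum>s\<in>l. emeasure \<mu> (G s)) \<le> ennreal K0" by (simp only: K0)
    moreover have "(\<Sum>s\<in>l. emeasure \<mu> (G s)) = (\<Sum>s\<in>l. emeasure \<mu> (B (\<lambda>_. 0) \<eta>))"
      unfolding G_def by (intro sum.cong refl trB)
    ultimately have le: "of_nat (card l) * emeasure \<mu> (B (\<lambda>_. 0) \<eta>) \<le> ennreal K0" by simp
    have cl: "card l = (\<Prod>j<d. m j)" by (simp add: l_def card_PiE)
    have prod1: "1 \<le> 2 ^ d * real (card l) * (\<Prod>j<d. \<eta> j)"
    proof -
      have "(\<Prod>j<d. (1::real)) \<le> (\<Prod>j<d. 2 * real (m j) * \<eta> j)"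
        using m by (intro prod_mono) auto
      then show ?thesis by (simp add: cl prod.distrib)
    qed
    have P0: "0 \<le> (\<Prod>j<d. \<eta> j)" using \<eta> by (intro prod_nonneg) auto
    have "emeasure \<mu> (B c \<eta>) = 1 * emeasure \<mu> (B (\<lambda>_. 0) \<eta>)" by (simp add: trB[of c])
    also have "\<dots> \<le> ennreal (2 ^ d * real (card l) * (\<Prod>j<d. \<eta> j)) * emeasure \<mu> (B (\<lambda>_. 0) \<eta>)"
      using prod1 by (intro mult_right_mono) auto
    also have "\<dots> = ennreal (2 ^ d * (\<Prod>j<d. \<eta> j)) * (of_nat (card l) * emeasure \<mu> (B (\<lambda>_. 0) \<eta>))"
      using P0 by (simp add: ennreal_mult ennreal_of_nat_eq_real_of_nat ac_simps)
    also have "\<dots> \<le> ennreal (2 ^ d * (\<Prod>j<d. \<eta> j)) * ennreal K0"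
      by (intro mult_left_mono le) auto
    also have "\<dots> = ennreal (2 ^ d * K0 * (\<Prod>j<d. \<eta> j))"
      using P0 by (subst ennreal_mult[symmetric]) (auto simp: K0_def ac_simps)
    finally show ?thesis .
  qed
  show ?thesis
    by (rule exI[of _ "2 ^ d * K0"]) (use main in \<open>simp add: B_def K0_def\<close>)
qed

section \<open>Measure of the points with prescribed dyadic distances\<close>

text \<open>The factor 2 absorbs the loss in rounding distances up to powers of two, so that the exponents
  needed to cover a set of small products may be required to have a prescribed sum.\<close>

definition near_box :: "real \<Rightarrow> nat \<Rightarrow> ('n \<Rightarrow> nat) \<Rightarrow> (real ^ 'n) set" where
  "near_box R m k = {x \<in> cball 0 R. \<exists>q\<in>{2 ^ m..<2 ^ (m + 1)}. \<forall>i. nint_dist (real q * x $ i) \<le> 2 / 2 ^ k i}"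

lemma near_box_borel [measurable]: "near_box R m k \<in> sets borel"
proof -
  have "{x. \<forall>i. nint_dist (real q * x $ i) \<le> 2 / 2 ^ k i} \<in> sets borel" for q
    by measurable
  moreover have "near_box R m k = cball 0 R \<inter>
      (\<Union>q\<in>{2 ^ m..<2 ^ (m + 1)}. {x. \<forall>i. nint_dist (real q * x $ i) \<le> 2 / 2 ^ k i})"
    by (auto simp: near_box_def)
  ultimately show ?thesis by auto
qed

lemma sum_UNIV_split:
  fixes k :: "'n::finite \<Rightarrow> 'a::comm_monoid_add"
  assumes "bij_betw e {..<CARD('n)} (UNIV :: 'n set)" "d \<le> CARD('n)"
  shows "(\<Sum>i\<in>UNIV. k i) = (\<Sum>j<d. k (e j)) + (\<Sum>i<CARD('n) - d. k (e (d + i)))"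
proof -
  have "(\<Sum>i\<in>UNIV. k i) = (\<Sum>j<CARD('n). k (e j))"
    using assms(1) by (rule sum.reindex_bij_betw[symmetric])
  also have "{..<CARD('n)} = {..<d} \<union> {d..<CARD('n)}" using assms(2) by auto
  also have "(\<Sum>j\<in>{..<d} \<union> {d..<CARD('n)}. k (e j)) =
      (\<Sum>j<d. k (e j)) + (\<Sum>j=d..<CARD('n). k (e j))"
    by (rule sum.union_disjoint) auto
  also have "(\<Sum>j=d..<CARD('n). k (e j)) = (\<Sum>i<CARD('n) - d. k (e (d + i)))"
    using sum.shift_bounds_nat_ivl[of "\<lambda>j. k (e j)" 0 d "CARD('n) - d"] assms(2)
    by (simp add: atLeast0LessThan add.commute)
  finally show ?thesis .
qed

text \<open>Hypothesis D at \<open>T = 2^K\<close> and \<open>\<sigma> = \<kappa>/K\<close>, with \<open>K\<close> the sum and \<open>\<kappa>\<close> the largest of the exponents of the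
  dependent coordinates. Then \<open>T^\<sigma> = 2^\<kappa>\<close> bounds the sup norm of \<open>\<xi>\<close> and \<open>T\<close> its height, and \<open>\<sigma>\<close> lies in the admissible range because
  \<open>\<kappa> \<le> K \<le> (n - d) \<kappa>\<close>. Since \<open>k\<close> decreases, the parameters have exponents at least \<open>\<kappa>\<close>, so that
  \<open>K (1 + d \<sigma>) = K + d \<kappa>\<close> is at most the sum of all \<open>k i\<close>. A nonzero \<open>\<xi>\<close> exists only if \<open>K > 0\<close>.\<close>

lemma hypothesis_D_separation:
  fixes L :: "(real ^ 'n) set" and k :: "'n \<Rightarrow> nat" and \<xi> :: "nat \<Rightarrow> int"
  assumes mon: "monge_parametrisation d L e A b" and d: "d < CARD('n)"
    and \<gamma>: "\<gamma> \<ge> 0" and c: "c > 0"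
    and D: "\<And>\<sigma>. 1 / (real CARD('n) - real d) \<le> \<sigma> \<Longrightarrow> \<sigma> \<le> 1 \<Longrightarrow>
      hypothesis_D_at d L c (\<gamma> * (1 + real d * \<sigma>)) \<sigma>"
    and sorted: "\<And>i j. i \<le> j \<Longrightarrow> j < CARD('n) \<Longrightarrow> k (e j) \<le> k (e i)"
    and m: "\<gamma> * real (\<Sum>i\<in>UNIV. k i) \<le> real m"
    and \<xi>: "\<exists>i<CARD('n) - d. \<xi> i \<noteq> 0" "\<And>i. i < CARD('n) - d \<Longrightarrow> \<bar>\<xi> i\<bar> < 2 ^ k (e (d + i))"
  shows "\<exists>j<d + 1. c / 2 ^ m \<le>
    nint_dist (\<Sum>i<CARD('n) - d. real_of_int (\<xi> i) * (if j < d then A i j else b i))"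
proof -
  define N where "N = CARD('n) - d"
  define K where "K = (\<Sum>i<N. k (e (d + i)))"
  define \<kappa> where "\<kappa> = k (e d)"
  define \<sigma> where "\<sigma> = real \<kappa> / real K"
  have e: "bij_betw e {..<CARD('n)} UNIV" using mon by (simp add: monge_parametrisation_def)
  have N: "N > 0" "real N = real CARD('n) - real d" using d by (auto simp: N_def of_nat_diff)
  have \<xi>': "\<exists>i<N. \<xi> i \<noteq> 0" "\<And>i. i < N \<Longrightarrow> \<bar>\<xi> i\<bar> < 2 ^ k (e (d + i))" using \<xi> by (auto simp: N_def)
  have kk: "k (e (d + i)) \<le> \<kappa>" if "i < N" for i
    unfolding \<kappa>_def using that by (intro sorted) (auto simp: N_def)
  have Kle: "K \<le> N * \<kappa>"
    unfolding K_def using sum_bounded_above[of "{..<N}" "\<lambda>i. k (e (d + i))" \<kappa>] kk by simp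
  have \<kappa>K: "\<kappa> \<le> K"
    unfolding K_def \<kappa>_def using member_le_sum[of 0 "{..<N}" "\<lambda>i. k (e (d + i))"] N by simp
  have Kpos: "K > 0"
  proof -
    obtain i where i: "i < N" "\<xi> i \<noteq> 0" using \<xi>' by blast
    have "k (e (d + i)) \<noteq> 0" using \<xi>'(2)[OF i(1)] i(2) by (intro notI) simp
    then show ?thesis using kk[OF i(1)] \<kappa>K by linarith
  qed
  have sum_ge: "K + d * \<kappa> \<le> (\<Sum>i\<in>UNIV. k i)"
  proof -
    have "d * \<kappa> \<le> (\<Sum>j<d. k (e j))"
      using sum_bounded_below[of "{..<d}" \<kappa> "\<lambda>j. k (e j)"] sorted d by (simp add: \<kappa>_def)
    then show ?thesis
      using sum_UNIV_split[OF e, of d k] d by (simp add: K_def N_def)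
  qed
  have "1 / (real CARD('n) - real d) \<le> \<sigma>"
  proof -
    have "real K \<le> real N * real \<kappa>" using Kle by (metis of_nat_le_iff of_nat_mult)
    then show ?thesis unfolding N(2)[symmetric] \<sigma>_def using N(1) Kpos by (simp add: field_simps)
  qed
  moreover have "\<sigma> \<le> 1" unfolding \<sigma>_def using \<kappa>K Kpos by simp
  ultimately have "hypothesis_D_at d L c (\<gamma> * (1 + real d * \<sigma>)) \<sigma>" by (rule D)
  then have D': "(\<exists>i<N. \<xi> i \<noteq> 0) \<Longrightarrow> real_of_int (sup_norm_int N \<xi>) \<le> (2 ^ K) powr \<sigma> \<Longrightarrow>
      real_of_int (mult_height N \<xi>) \<le> 2 ^ K \<Longrightarrow>
      c * (2 ^ K) powr (- (\<gamma> * (1 + real d * \<sigma>))) \<le>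
      Max (insert (nint_dist (int_dot N \<xi> b)) ((\<lambda>j. nint_dist (int_dot N \<xi> (\<lambda>i. A i j))) ` {..<d}))"
    using mon unfolding hypothesis_D_at_def Let_def N_def by simp
  have pow: "(2 ^ K :: real) powr s = 2 powr (real K * s)" for s
    by (simp add: powr_powr flip: powr_realpow)
  have "real_of_int (sup_norm_int N \<xi>) \<le> (2 ^ K) powr \<sigma>"
  proof -
    have "sup_norm_int N \<xi> \<le> 2 ^ \<kappa>"
      unfolding sup_norm_int_def
    proof (rule Max.boundedI)
      fix z assume "z \<in> (\<lambda>i. \<bar>\<xi> i\<bar>) ` {..<N}"
      then obtain i where i: "i < N" "z = \<bar>\<xi> i\<bar>" by blast
      have "z < 2 ^ k (e (d + i))" using \<xi>'(2)[OF i(1)] i by simp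
      also have "\<dots> \<le> (2::int) ^ \<kappa>" using kk[OF i(1)] by (intro power_increasing) auto
      finally show "z \<le> 2 ^ \<kappa>" by simp
    qed (use N in auto)
    then have "real_of_int (sup_norm_int N \<xi>) \<le> 2 ^ \<kappa>"
      by (metis of_int_le_iff of_int_numeral of_int_power)
    also have "\<dots> = (2 ^ K) powr \<sigma>"
      unfolding pow \<sigma>_def using Kpos by (simp add: powr_realpow)
    finally show ?thesis .
  qed
  moreover have "real_of_int (mult_height N \<xi>) \<le> 2 ^ K"
  proof -
    have "mult_height N \<xi> \<le> (\<Prod>i<N. 2 ^ k (e (d + i)))"
      unfolding mult_height_def
    proof (intro prod_mono conjI)
      fix i assume "i \<in> {..<N}"
      then show "max 1 \<bar>\<xi> i\<bar> \<le> 2 ^ k (e (d + i))" using \<xi>'(2)[of i] by simp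
    qed simp
    also have "\<dots> = 2 ^ K" by (simp add: K_def power_sum)
    finally show ?thesis by (metis of_int_le_iff of_int_numeral of_int_power)
  qed
  ultimately have Max: "c * (2 ^ K) powr (- (\<gamma> * (1 + real d * \<sigma>))) \<le>
      Max (insert (nint_dist (int_dot N \<xi> b)) ((\<lambda>j. nint_dist (int_dot N \<xi> (\<lambda>i. A i j))) ` {..<d}))"
    (is "_ \<le> Max ?Z")
    using D' \<xi>' by blast
  have "c / 2 ^ m \<le> c * (2 ^ K) powr (- (\<gamma> * (1 + real d * \<sigma>)))"
  proof -
    have "real K * (\<gamma> * (1 + real d * \<sigma>)) = \<gamma> * real (K + d * \<kappa>)"
      unfolding \<sigma>_def using Kpos by (simp add: field_simps)
    also have "\<dots> \<le> \<gamma> * real (\<Sum>i\<in>UNIV. k i)"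
      using sum_ge \<gamma> by (intro mult_left_mono) (simp_all only: of_nat_le_iff)
    also have "\<dots> \<le> real m" by (rule m)
    finally have "2 powr (- real m) \<le> (2 ^ K :: real) powr (- (\<gamma> * (1 + real d * \<sigma>)))"
      unfolding pow by simp
    moreover have "2 powr (- real m) = 1 / (2::real) ^ m"
      by (simp add: powr_minus powr_realpow divide_inverse)
    ultimately show ?thesis using c by (simp add: mult_left_mono[of _ _ c] divide_inverse)
  qed
  then have "c / 2 ^ m \<le> Max ?Z" using Max by linarith
  moreover have "Max ?Z \<in> ?Z" by (rule Max_in) auto
  ultimately obtain z where z: "z \<in> ?Z" "c / 2 ^ m \<le> z" by blast
  show ?thesis
  proof (cases "z = nint_dist (int_dot N \<xi> b)")
    case True
    then show ?thesis using z by (intro exI[of _ d]) (simp add: int_dot_def N_def)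
  next
    case False
    then obtain j where "j < d" "z = nint_dist (int_dot N \<xi> (\<lambda>i. A i j))" using z by auto
    then show ?thesis using z by (intro exI[of _ j]) (simp add: int_dot_def N_def)
  qed
qed

text \<open>The set is covered by slabs indexed by the integer vectors \<open>y\<close> with \<open>y\<^sub>d = q\<close> and \<open>y\<^sub>j\<close> the integer nearest
  to \<open>q x\<^sub>j\<close> for \<open>j < d\<close>; the number of relevant \<open>y\<close> comes from \<open>count_near_integer_points\<close> with
  \<open>D = d + 1\<close> and \<open>b\<close> as the last column of the matrix.\<close>

lemma near_box_measure_sorted:
  fixes L :: "(real ^ 'n) set" and R :: nat
  assumes \<mu>: "flat_measure L \<mu>" and mon: "monge_parametrisation d L e A b" and d: "d < CARD('n)"
    and \<gamma>: "\<gamma> \<ge> 0" and c: "c > 0" and R: "R \<ge> 1"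
    and D: "\<And>\<sigma>. 1 / (real CARD('n) - real d) \<le> \<sigma> \<Longrightarrow> \<sigma> \<le> 1 \<Longrightarrow>
      hypothesis_D_at d L c (\<gamma> * (1 + real d * \<sigma>)) \<sigma>"
  shows "\<exists>C\<ge>0. \<forall>m\<ge>3. \<forall>k. (\<forall>j<CARD('n). \<forall>i\<le>j. k (e j) \<le> k (e i)) \<longrightarrow>
      \<gamma> * real (\<Sum>i\<in>UNIV. k i) \<le> real m \<longrightarrow>
      emeasure \<mu> (near_box (real R) m k) \<le> ennreal (C * 2 ^ m / 2 ^ (\<Sum>i\<in>UNIV. k i))"
proof -
  define N where "N = CARD('n) - d"
  have e: "bij_betw e {..<CARD('n)} UNIV" using mon by (simp add: monge_parametrisation_def)
  have sets [simp]: "sets \<mu> = sets borel" and null: "emeasure \<mu> (- L) = 0" and Lb: "L \<in> sets borel"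
    using \<mu> by (auto simp: flat_measure_def)
  have Lmem: "x \<in> L \<longleftrightarrow> (\<forall>i<N. x $ e (d + i) = (\<Sum>j<d. A i j * x $ e j) + b i)" for x
    using mon unfolding monge_parametrisation_def N_def by auto
  obtain C2 where C2: "C2 \<ge> 0" "\<And>c \<eta>. (\<forall>j<d. 0 < \<eta> j \<and> \<eta> j \<le> 1) \<Longrightarrow>
     emeasure \<mu> {x. \<forall>j<d. c j \<le> x $ e j \<and> x $ e j < c j + \<eta> j} \<le> ennreal (C2 * (\<Prod>j<d. \<eta> j))"
    using monge_slab_measure[OF \<mu> mon d] by blast
  define a where "a = (\<lambda>i. 1 + (\<Sum>j<d. \<bar>A i j\<bar>))"
  have a1: "1 \<le> a i" for i unfolding a_def by (simp add: sum_nonneg)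
  \<comment> \<open>\<open>2^h\<close> absorbs the loss in passing from \<open>q x\<close> to the integer vector \<open>y\<close>, as well as the factor 8 in the
    counting lemma.\<close>
  obtain h :: nat where "16 * (\<Sum>i<N. a i) < 2 ^ h"
    using real_arch_pow[of 2 "16 * (\<Sum>i<N. a i)"] by auto
  then have h: "16 * a i \<le> 2 ^ h" if "i < N" for i
  proof -
    have "a i \<le> (\<Sum>i<N. a i)" using that a1 by (intro member_le_sum) (auto intro: order_trans[OF zero_le_one])
    then show ?thesis using \<open>16 * (\<Sum>i<N. a i) < 2 ^ h\<close> by linarith
  qed
  define \<alpha> where "\<alpha> = (\<lambda>i j. if j < d then A i j else b i)"
  define Bd where "Bd = 2 * R + 1"
  define W1 where "W1 = 5 * (18 * real Bd ^ 2 + 8 / c ^ 2)"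
  define C1 where "C1 = 4 ^ N * 2 ^ (h * N) * W1 ^ (d + 1)"
  have W1: "W1 \<ge> 0" unfolding W1_def by simp
  have C1: "C1 \<ge> 0" unfolding C1_def using W1 by simp
  have main: "emeasure \<mu> (near_box (real R) m k) \<le> ennreal (C1 * C2 * 5 ^ d * 2 ^ m / 2 ^ (\<Sum>i\<in>UNIV. k i))"
    if m3: "m \<ge> 3" and srt: "\<forall>j<CARD('n). \<forall>i\<le>j. k (e j) \<le> k (e i)"
      and km: "\<gamma> * real (\<Sum>i\<in>UNIV. k i) \<le> real m" for m k
  proof -
    have sorted: "k (e j) \<le> k (e i)" if "i \<le> j" "j < CARD('n)" for i j using srt that by blast
    define K where "K = (\<Sum>i<N. k (e (d + i)))"
    define P where "P = 2 ^ m * Bd"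
    \<comment> \<open>The subtraction truncates: coordinates with \<open>k \<le> h\<close> get \<open>M = 1\<close> and impose no condition.\<close>
    define M where "M = (\<lambda>i. 2 ^ (k (e (d + i)) - h) :: nat)"
    define S where "S = {y \<in> PiE {..<d + 1} (\<lambda>_. {- int P..int P}).
        y d \<in> {2 ^ m..<2 ^ (m + 1)} \<and>
        (\<forall>i<N. nint_dist (\<Sum>j<d + 1. \<alpha> i j * real_of_int (y j)) \<le> a i * (2 / 2 ^ k (e (d + i))))}"
    have Sfin: "finite S"
      unfolding S_def by (rule finite_subset[of _ "PiE {..<d + 1} (\<lambda>_. {- int P..int P})"])
        (auto intro!: finite_PiE)
    have count: "real (card S) * real P ^ (d + 1) * (\<Prod>i<N. real (M i)) \<le>
        4 ^ N * (5 * (2 * real (3 * P) ^ 2 + 8 / (c / 2 ^ m) ^ 2)) ^ (d + 1)"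
    proof (rule count_near_integer_points[where \<alpha> = \<alpha>])
      show "0 < c / 2 ^ m" using c by simp
      show "S \<subseteq> extensional {..<d + 1}" by (auto simp: S_def PiE_def)
      show "\<bar>y j\<bar> \<le> int P" if "y \<in> S" "j < d + 1" for y j
        using that PiE_mem[of y "{..<d + 1}" "\<lambda>_. {- int P..int P}" j] unfolding S_def by auto
      show "0 < M i" for i by (simp add: M_def)
      show "M i = 1 \<or> real (M i) * nint_dist (\<Sum>j<d + 1. \<alpha> i j * real_of_int (y j)) \<le> 1 / 8"
        if "y \<in> S" "i < N" for y i
      proof (cases "k (e (d + i)) \<le> h")
        case True
        then show ?thesis by (simp add: M_def)
      next
        case False
        have "nint_dist (\<Sum>j<d + 1. \<alpha> i j * real_of_int (y j)) \<le> a i * (2 / 2 ^ k (e (d + i)))"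
          using that unfolding S_def by blast
        also have "\<dots> \<le> (2 ^ h / 16) * (2 / 2 ^ k (e (d + i)))"
          using h[OF that(2)] by (intro mult_right_mono) auto
        also have "\<dots> = 1 / (8 * real (M i))"
        proof -
          obtain l where "k (e (d + i)) = h + l" using False by (metis le_add_diff_inverse nat_le_linear)
          then show ?thesis by (simp add: M_def power_add)
        qed
        finally show ?thesis by (simp add: M_def field_simps)
      qed
      fix \<xi> :: "nat \<Rightarrow> int" assume \<xi>: "\<exists>i<N. \<xi> i \<noteq> 0" "\<forall>i<N. \<bar>\<xi> i\<bar> < int (M i)"
      have "\<bar>\<xi> i\<bar> < 2 ^ k (e (d + i))" if "i < N" for i
      proof -
        have "\<bar>\<xi> i\<bar> < 2 ^ (k (e (d + i)) - h)" using \<xi>(2) that by (simp add: M_def)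
        also have "\<dots> \<le> (2::int) ^ k (e (d + i))" by (intro power_increasing) auto
        finally show ?thesis .
      qed
      then show "\<exists>j<d + 1. c / 2 ^ m \<le> nint_dist (\<Sum>i<N. real_of_int (\<xi> i) * \<alpha> i j)"
        unfolding \<alpha>_def N_def
        by (intro hypothesis_D_separation[OF mon d \<gamma> c D sorted km]) (use \<xi> in \<open>auto simp: N_def\<close>)
    qed (rule Sfin)
    have Pr: "real P = 2 ^ m * real Bd" by (simp add: P_def)
    have Bd1: "1 \<le> real Bd" by (simp add: Bd_def)
    have "5 * (2 * real (3 * P) ^ 2 + 8 / (c / 2 ^ m) ^ 2) = (2 ^ m) ^ 2 * W1"
      using c by (simp add: Pr W1_def field_simps power2_eq_square)
    then have count2: "real (card S) * real P ^ (d + 1) * (\<Prod>i<N. real (M i)) \<le>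
        4 ^ N * ((2 ^ m) ^ 2 * W1) ^ (d + 1)" using count by simp
    have Mge: "2 ^ K \<le> 2 ^ (h * N) * (\<Prod>i<N. real (M i))"
    proof -
      have "(2::real) ^ K = (\<Prod>i<N. 2 ^ k (e (d + i)))" by (simp add: K_def power_sum)
      also have "\<dots> \<le> (\<Prod>i<N. 2 ^ h * real (M i))"
      proof (intro prod_mono conjI)
        fix i
        have "(2::real) ^ k (e (d + i)) \<le> 2 ^ (h + (k (e (d + i)) - h))" by (intro power_increasing) auto
        then show "(2::real) ^ k (e (d + i)) \<le> 2 ^ h * real (M i)" by (simp add: M_def power_add)
      qed simp
      also have "\<dots> = 2 ^ (h * N) * (\<Prod>i<N. real (M i))" by (simp add: prod.distrib power_mult)
      finally show ?thesis .
    qed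
    have cardS: "real (card S) * 2 ^ K \<le> C1 * (2 ^ m) ^ (d + 1)"
    proof -
      define X where "X = (2::real) ^ m"
      have X: "X > 0" by (simp add: X_def)
      have "real (card S) * X ^ (d + 1) * 2 ^ K \<le>
          real (card S) * real P ^ (d + 1) * (2 ^ (h * N) * (\<Prod>i<N. real (M i)))"
        unfolding Pr X_def[symmetric] using Bd1 X Mge
        by (intro mult_mono power_mono) auto
      also have "\<dots> = 2 ^ (h * N) * (real (card S) * real P ^ (d + 1) * (\<Prod>i<N. real (M i)))" by simp
      also have "\<dots> \<le> 2 ^ (h * N) * (4 ^ N * (X ^ 2 * W1) ^ (d + 1))"
        using count2 unfolding X_def by (intro mult_left_mono) auto
      also have "\<dots> = (C1 * X ^ (d + 1)) * X ^ (d + 1)"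
        unfolding C1_def power_mult_distrib by (simp add: power2_eq_square power_mult_distrib)
      finally have "(real (card S) * 2 ^ K) * X ^ (d + 1) \<le> (C1 * X ^ (d + 1)) * X ^ (d + 1)"
        by (simp only: mult_ac)
      then show ?thesis unfolding X_def[symmetric] using X by (simp del: power_Suc)
    qed
    \<comment> \<open>The distance of \<open>x\<close> from \<open>y/q\<close> is at most \<open>2/(2^m 2^k)\<close> on either side; 5 instead of 4 makes room for
    the strict inequality at the right end, and \<open>m \<ge> 3\<close> keeps \<open>\<eta>\<close> below 1.\<close>
    define \<eta> where "\<eta> = (\<lambda>j. 5 / (2 ^ m * 2 ^ k (e j)) :: real)"
    have \<eta>: "\<forall>j<d. 0 < \<eta> j \<and> \<eta> j \<le> 1"
    proof (intro allI impI)
      fix j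
      have "(2::real) ^ 3 * 1 \<le> 2 ^ m * 2 ^ k (e j)" using m3
        by (intro mult_mono power_increasing) auto
      then show "0 < \<eta> j \<and> \<eta> j \<le> 1" by (simp add: \<eta>_def)
    qed
    define slab where "slab = (\<lambda>y::nat \<Rightarrow> int. {x :: real ^ 'n. \<forall>j<d.
        real_of_int (y j) / real_of_int (y d) - 2 / (2 ^ m * 2 ^ k (e j)) \<le> x $ e j \<and>
        x $ e j < real_of_int (y j) / real_of_int (y d) - 2 / (2 ^ m * 2 ^ k (e j)) + \<eta> j})"
    have slab_b: "slab y \<in> sets borel" for y unfolding slab_def by measurable
    have slab_m: "emeasure \<mu> (slab y) \<le> ennreal (C2 * (\<Prod>j<d. \<eta> j))" for y
      unfolding slab_def by (rule C2(2)[OF \<eta>])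
    have cover: "near_box (real R) m k \<inter> L \<subseteq> (\<Union>y\<in>S. slab y)"
    proof
      fix x assume x: "x \<in> near_box (real R) m k \<inter> L"
      then obtain q where q: "q \<in> {2 ^ m..<2 ^ (m + 1)}" "\<And>i. nint_dist (real q * x $ i) \<le> 2 / 2 ^ k i"
        and xR: "norm x \<le> real R" by (auto simp: near_box_def)
      have q1: "(2::real) ^ m \<le> real q" "real q \<le> 2 ^ (m + 1)" "real q > 0"
      proof -
        have "2 ^ m \<le> q" "q \<le> 2 ^ (m + 1)" using q(1) by auto
        then show "(2::real) ^ m \<le> real q" "real q \<le> 2 ^ (m + 1)"
          by (metis of_nat_le_iff of_nat_numeral of_nat_power)+
        then show "real q > 0" by (smt (verit) zero_less_power)
      qed
      define y where "y = (\<lambda>j\<in>{..<d + 1}. if j < d then round (real q * x $ e j) else int q)"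
      have yd: "y d = int q" by (simp add: y_def)
      have yj: "\<bar>real q * x $ e j - real_of_int (y j)\<bar> \<le> 2 / 2 ^ k (e j)" if "j < d" for j
        using q(2)[of "e j"] that by (simp add: y_def nint_dist_eq)
      have "y \<in> S"
        unfolding S_def
      proof (intro CollectI conjI allI impI)
        show "y d \<in> {2 ^ m..<2 ^ (m + 1)}"
        proof -
          have "int (2 ^ m) \<le> int q" "int q < int (2 ^ (m + 1))" using q(1) by (simp_all only: of_nat_le_iff of_nat_less_iff atLeastLessThan_iff)
          then show ?thesis by (simp add: yd)
        qed
        show "y \<in> PiE {..<d + 1} (\<lambda>_. {- int P..int P})"
        proof (rule PiE_I)
          fix j assume j: "j \<in> {..<d + 1}"
          have "\<bar>real_of_int (y j)\<bar> \<le> real P"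
          proof (cases "j < d")
            case True
            have "\<bar>x $ e j\<bar> \<le> real R" using xR component_le_norm_cart[of x "e j"] by linarith
            then have "real q * \<bar>x $ e j\<bar> \<le> 2 ^ (m + 1) * real R"
              using q1 by (intro mult_mono) auto
            then have "\<bar>real q * x $ e j\<bar> \<le> 2 ^ (m + 1) * real R" by (simp add: abs_mult)
            moreover have "\<bar>real q * x $ e j - real_of_int (y j)\<bar> \<le> 1 / 2"
              using nint_dist_le_half[of "real q * x $ e j"] True by (simp add: y_def nint_dist_eq)
            moreover have "(1::real) \<le> 2 ^ m" by simp
            moreover have "real P = 2 ^ (m + 1) * real R + 2 ^ m" unfolding Pr Bd_def by (simp add: algebra_simps)
            ultimately show ?thesis by linarith
          next
            case False
            then have "j = d" using j by auto
            have "(2::real) ^ (m + 1) \<le> 2 ^ m * real Bd" using R by (simp add: Bd_def)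
            then have "real q \<le> real P" using q1(2) unfolding Pr by linarith
            then show ?thesis using yd \<open>j = d\<close> by simp
          qed
          then show "y j \<in> {- int P..int P}" by auto
        next
          show "\<And>j. j \<notin> {..<d + 1} \<Longrightarrow> y j = undefined" by (simp add: y_def)
        qed
        fix i assume i: "i < N"
        define v where "v = real q * x $ e (d + i)"
        have v: "nint_dist v \<le> 2 / 2 ^ k (e (d + i))" unfolding v_def by (rule q(2))
        have "(\<Sum>j<d + 1. \<alpha> i j * real_of_int (y j)) = (\<Sum>j<d. A i j * real_of_int (y j)) + b i * real q"
          by (simp add: \<alpha>_def yd)
        moreover have "v = (\<Sum>j<d. A i j * (real q * x $ e j)) + b i * real q"
          using x i by (simp add: v_def Lmem distrib_left sum_distrib_left mult_ac)
        ultimately have "(\<Sum>j<d + 1. \<alpha> i j * real_of_int (y j)) - v =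
            (\<Sum>j<d. A i j * (real_of_int (y j) - real q * x $ e j))"
          by (simp add: right_diff_distrib sum_subtractf)
        also have "\<bar>\<dots>\<bar> \<le> (\<Sum>j<d. \<bar>A i j * (real_of_int (y j) - real q * x $ e j)\<bar>)" by (rule sum_abs)
        also have "\<dots> \<le> (\<Sum>j<d. \<bar>A i j\<bar> * (2 / 2 ^ k (e (d + i))))"
        proof (rule sum_mono)
          fix j assume j: "j \<in> {..<d}"
          have "\<bar>real_of_int (y j) - real q * x $ e j\<bar> \<le> 2 / 2 ^ k (e j)" using yj[of j] j by (simp add: abs_minus_commute)
          also have "\<dots> \<le> 2 / 2 ^ k (e (d + i))"
            using sorted[of j "d + i"] i j d by (intro divide_left_mono power_increasing) (auto simp: N_def)
          finally show "\<bar>A i j * (real_of_int (y j) - real q * x $ e j)\<bar> \<le> \<bar>A i j\<bar> * (2 / 2 ^ k (e (d + i)))"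
            unfolding abs_mult by (intro mult_left_mono) auto
        qed
        also have "\<dots> = (\<Sum>j<d. \<bar>A i j\<bar>) * (2 / 2 ^ k (e (d + i)))" by (rule sum_distrib_right[symmetric])
        finally have "\<bar>(\<Sum>j<d + 1. \<alpha> i j * real_of_int (y j)) - v\<bar> \<le> (\<Sum>j<d. \<bar>A i j\<bar>) * (2 / 2 ^ k (e (d + i)))" .
        then have "nint_dist (\<Sum>j<d + 1. \<alpha> i j * real_of_int (y j)) \<le>
            2 / 2 ^ k (e (d + i)) + (\<Sum>j<d. \<bar>A i j\<bar>) * (2 / 2 ^ k (e (d + i)))"
          using nint_dist_le_perturb[of "\<Sum>j<d + 1. \<alpha> i j * real_of_int (y j)" v] v by linarith
        then show "nint_dist (\<Sum>j<d + 1. \<alpha> i j * real_of_int (y j)) \<le> a i * (2 / 2 ^ k (e (d + i)))"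
          by (simp only: a_def distrib_right mult_1_left)
      qed
      moreover have "x \<in> slab y"
        unfolding slab_def
      proof (intro CollectI allI impI)
        fix j assume j: "j < d"
        have "\<bar>x $ e j - real_of_int (y j) / real q\<bar> * real q = \<bar>real q * x $ e j - real_of_int (y j)\<bar>"
          using q1 by (simp add: field_simps flip: abs_mult_pos)
        also have "\<dots> \<le> 2 / 2 ^ k (e j)" by (rule yj[OF j])
        finally have "\<bar>x $ e j - real_of_int (y j) / real q\<bar> \<le> 2 / 2 ^ k (e j) / real q"
          using q1(3) by (simp add: pos_le_divide_eq mult_ac)
        also have "\<dots> \<le> 2 / 2 ^ k (e j) / 2 ^ m" using q1 by (intro divide_left_mono) auto
        finally have *: "\<bar>x $ e j - real_of_int (y j) / real q\<bar> \<le> 2 / (2 ^ m * 2 ^ k (e j))" by (simp add: mult.commute)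
        have "(0::real) < 1 / (2 ^ m * 2 ^ k (e j))" by simp
        moreover have "\<eta> j = 5 * (1 / (2 ^ m * 2 ^ k (e j)))" "2 / (2 ^ m * 2 ^ k (e j)) = 2 * (1 / (2 ^ m * 2 ^ k (e j)) :: real)"
          by (simp_all add: \<eta>_def)
        ultimately show "real_of_int (y j) / real_of_int (y d) - 2 / (2 ^ m * 2 ^ k (e j)) \<le> x $ e j \<and>
            x $ e j < real_of_int (y j) / real_of_int (y d) - 2 / (2 ^ m * 2 ^ k (e j)) + \<eta> j"
          using * unfolding yd of_int_of_nat_eq by linarith
      qed
      ultimately show "x \<in> (\<Union>y\<in>S. slab y)" by blast
    qed
    have slabs: "(\<Union>y\<in>S. slab y) \<in> sets borel" by (intro sets.finite_UN Sfin slab_b)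
    have Lc: "- L \<in> sets borel" using Lb by auto
    have "emeasure \<mu> (near_box (real R) m k) \<le> emeasure \<mu> (- L \<union> (\<Union>y\<in>S. slab y))"
      using cover by (intro emeasure_mono) (auto simp only: sets intro!: sets.Un Lc slabs)
    also have "\<dots> \<le> emeasure \<mu> (- L) + emeasure \<mu> (\<Union>y\<in>S. slab y)"
      using Lc slabs by (intro emeasure_subadditive) (simp_all only: sets)
    also have "\<dots> \<le> (\<Sum>y\<in>S. emeasure \<mu> (slab y))"
      using null Sfin slab_b by (simp add: emeasure_subadditive_finite image_subset_iff)
    also have "\<dots> \<le> (\<Sum>y\<in>S. ennreal (C2 * (\<Prod>j<d. \<eta> j)))" by (intro sum_mono slab_m)
    also have "\<dots> = ennreal (real (card S) * (C2 * (\<Prod>j<d. \<eta> j)))"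
    proof -
      have "0 \<le> C2 * (\<Prod>j<d. \<eta> j)"
        using \<eta> by (intro mult_nonneg_nonneg prod_nonneg C2(1)) (simp add: less_imp_le)
      then show ?thesis by (subst sum_ennreal) simp_all
    qed
    also have "\<dots> \<le> ennreal (C1 * C2 * 5 ^ d * 2 ^ m / 2 ^ (\<Sum>i\<in>UNIV. k i))"
    proof (rule ennreal_leI)
      define s where "s = (\<Sum>j<d. k (e j))"
      have sk: "(\<Sum>i\<in>UNIV. k i) = s + K"
        using sum_UNIV_split[OF e, of d k] d by (simp add: s_def K_def N_def)
      have "(\<Prod>j<d. \<eta> j) = 5 ^ d / ((2 ^ m) ^ d * 2 ^ s)"
        by (simp add: \<eta>_def prod_dividef prod.distrib s_def power_sum)
      then have "real (card S) * (C2 * (\<Prod>j<d. \<eta> j)) = (real (card S) * 2 ^ K) * (C2 * 5 ^ d / ((2 ^ m) ^ d * 2 ^ s * 2 ^ K))"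
        by simp
      also have "\<dots> \<le> (C1 * (2 ^ m) ^ (d + 1)) * (C2 * 5 ^ d / ((2 ^ m) ^ d * 2 ^ s * 2 ^ K))"
        using C2(1) by (intro mult_right_mono cardS) auto
      also have "\<dots> = C1 * C2 * 5 ^ d * 2 ^ m / 2 ^ (\<Sum>i\<in>UNIV. k i)"
        unfolding sk power_add by simp
      finally show "real (card S) * (C2 * (\<Prod>j<d. \<eta> j)) \<le> C1 * C2 * 5 ^ d * 2 ^ m / 2 ^ (\<Sum>i\<in>UNIV. k i)" .
    qed
    finally show ?thesis .
  qed
  show ?thesis
    by (rule exI[of _ "C1 * C2 * 5 ^ d"]) (use main C1 C2(1) in simp)
qed

text \<open>The enumeration is made extensional because only finitely many of these exist, which allows one
  constant for all \<open>k\<close> later on.\<close>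

lemma ex_decreasing_enumeration:
  fixes k :: "'n::finite \<Rightarrow> nat"
  shows "\<exists>e\<in>{..<CARD('n)} \<rightarrow>\<^sub>E UNIV. bij_betw e {..<CARD('n)} (UNIV :: 'n set) \<and>
    (\<forall>j<CARD('n). \<forall>i\<le>j. k (e j) \<le> k (e i))"
proof -
  obtain xs where xs: "set xs = (UNIV :: 'n set)" "distinct xs"
    using finite_distinct_list[OF finite_class.finite_UNIV] by metis
  define ys where "ys = rev (sort_key k xs)"
  have ys: "set ys = UNIV" "distinct ys" using xs by (simp_all add: ys_def)
  then have len: "length ys = CARD('n)" by (metis distinct_card)
  have dec: "k (ys ! j) \<le> k (ys ! i)" if "i \<le> j" "j < CARD('n)" for i j
  proof -
    have "sorted (rev (map k ys))" by (simp add: ys_def flip: rev_map)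
    then have "map k ys ! j \<le> map k ys ! i"
      using that len by (intro sorted_rev_nth_mono) auto
    then show ?thesis using that len by simp
  qed
  define e where "e = (\<lambda>j\<in>{..<CARD('n)}. ys ! j)"
  have "bij_betw ((!) ys) {..<CARD('n)} UNIV"
    using ys len by (intro bij_betw_nth) auto
  then have "bij_betw e {..<CARD('n)} UNIV"
    by (rule bij_betw_cong[THEN iffD1, rotated]) (simp add: e_def)
  then show ?thesis using dec by (intro bexI[of _ e]) (auto simp: e_def)
qed

text \<open>Only finitely many orders of the coordinates occur, so the constants belonging to their Monge
  parametrisations have a common bound.\<close>

lemma near_box_measure:
  fixes L :: "(real ^ 'n) set" and R :: nat
  assumes L: "affine L" "aff_dim L = int d" and d: "d < CARD('n)"
    and \<mu>: "flat_measure L \<mu>" and surj: "surjective_projections d L"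
    and \<gamma>: "\<gamma> \<ge> 0" and c: "c > 0" and R: "R \<ge> 1"
    and D: "\<And>\<sigma>. 1 / (real CARD('n) - real d) \<le> \<sigma> \<Longrightarrow> \<sigma> \<le> 1 \<Longrightarrow>
      hypothesis_D_at d L c (\<gamma> * (1 + real d * \<sigma>)) \<sigma>"
  shows "\<exists>C\<ge>0. \<forall>m\<ge>3. \<forall>k. \<gamma> * real (\<Sum>i\<in>UNIV. k i) \<le> real m \<longrightarrow>
      emeasure \<mu> (near_box (real R) m k) \<le> ennreal (C * 2 ^ m / 2 ^ (\<Sum>i\<in>UNIV. k i))"
proof -
  define E where "E = {e \<in> {..<CARD('n)} \<rightarrow>\<^sub>E (UNIV :: 'n set). bij_betw e {..<CARD('n)} UNIV}"
  have E: "finite E"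
    unfolding E_def by (rule finite_subset[of _ "{..<CARD('n)} \<rightarrow>\<^sub>E (UNIV :: 'n set)"])
      (auto intro!: finite_PiE)
  have "\<exists>C. \<forall>e\<in>E. C e \<ge> 0 \<and> (\<forall>m\<ge>3. \<forall>k. (\<forall>j<CARD('n). \<forall>i\<le>j. k (e j) \<le> k (e i)) \<longrightarrow>
      \<gamma> * real (\<Sum>i\<in>UNIV. k i) \<le> real m \<longrightarrow>
      emeasure \<mu> (near_box (real R) m k) \<le> ennreal (C e * 2 ^ m / 2 ^ (\<Sum>i\<in>UNIV. k i)))"
  proof (rule bchoice, rule ballI)
    fix e assume "e \<in> E"
    then obtain A b where mon: "monge_parametrisation d L e A b"
      using ex_monge_parametrisation[OF L d surj, of e] by (auto simp: E_def)
    show "\<exists>C. C \<ge> 0 \<and> (\<forall>m\<ge>3. \<forall>k. (\<forall>j<CARD('n). \<forall>i\<le>j. k (e j) \<le> k (e i)) \<longrightarrow>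
      \<gamma> * real (\<Sum>i\<in>UNIV. k i) \<le> real m \<longrightarrow>
      emeasure \<mu> (near_box (real R) m k) \<le> ennreal (C * 2 ^ m / 2 ^ (\<Sum>i\<in>UNIV. k i)))"
      by (rule near_box_measure_sorted[OF \<mu> mon d \<gamma> c R D])
  qed
  then obtain C where C0: "\<And>e. e \<in> E \<Longrightarrow> C e \<ge> 0"
    and C: "\<And>e m k. e \<in> E \<Longrightarrow> m \<ge> 3 \<Longrightarrow> \<forall>j<CARD('n). \<forall>i\<le>j. k (e j) \<le> k (e i) \<Longrightarrow>
      \<gamma> * real (\<Sum>i\<in>UNIV. k i) \<le> real m \<Longrightarrow>
      emeasure \<mu> (near_box (real R) m k) \<le> ennreal (C e * 2 ^ m / 2 ^ (\<Sum>i\<in>UNIV. k i))"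
    by blast
  show ?thesis
  proof (intro exI[of _ "\<Sum>e\<in>E. C e"] conjI allI impI)
    show "0 \<le> (\<Sum>e\<in>E. C e)" by (intro sum_nonneg C0)
    fix m :: nat and k :: "'n \<Rightarrow> nat"
    assume m: "3 \<le> m" "\<gamma> * real (\<Sum>i\<in>UNIV. k i) \<le> real m"
    obtain e where e: "e \<in> E" "\<forall>j<CARD('n). \<forall>i\<le>j. k (e j) \<le> k (e i)"
      using ex_decreasing_enumeration[of k] by (auto simp: E_def)
    have "emeasure \<mu> (near_box (real R) m k) \<le> ennreal (C e * 2 ^ m / 2 ^ (\<Sum>i\<in>UNIV. k i))"
      by (rule C[OF e(1) m(1) e(2) m(2)])
    also have "\<dots> \<le> ennreal ((\<Sum>e\<in>E. C e) * 2 ^ m / 2 ^ (\<Sum>i\<in>UNIV. k i))"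
      using E e C0 by (intro ennreal_leI divide_right_mono mult_right_mono member_le_sum) auto
    finally show "emeasure \<mu> (near_box (real R) m k) \<le> ennreal ((\<Sum>e\<in>E. C e) * 2 ^ m / 2 ^ (\<Sum>i\<in>UNIV. k i))" .
  qed
qed

section \<open>Dyadic covering and condensation\<close>

lemma ex_le_with_sum:
  fixes \<kappa> :: "'a \<Rightarrow> nat"
  assumes "finite I" "s \<le> (\<Sum>i\<in>I. \<kappa> i)"
  shows "\<exists>k. (\<forall>i. k i \<le> \<kappa> i) \<and> (\<Sum>i\<in>I. k i) = s"
  using assms
proof (induction I arbitrary: s rule: finite_induct)
  case empty
  then show ?case by auto
next
  case (insert a I)
  define t where "t = min s (\<Sum>i\<in>I. \<kappa> i)"
  obtain k where k: "\<forall>i. k i \<le> \<kappa> i" "(\<Sum>i\<in>I. k i) = t"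
    using insert.IH[of t] by (auto simp: t_def)
  have "(\<Sum>i\<in>I. (k(a := s - t)) i) = t"
    using insert.hyps k by (auto intro: sum.cong simp: fun_upd_def)
  moreover have "s - t \<le> \<kappa> a" "t \<le> s" using insert.prems insert.hyps by (auto simp: t_def)
  ultimately show ?case
    using insert.hyps k(1) by (intro exI[of _ "k(a := s - t)"]) auto
qed

text \<open>Take the largest exponent \<open>\<kappa> i \<le> s\<close> admissible for each \<open>t i\<close>. If their sum were below \<open>s\<close>, each would be below
  the cap \<open>s\<close>, hence \<open>t i > 2^(- \<kappa> i)\<close>, and the product would be too large. Then lower the exponents until their sum is
  exactly \<open>s\<close>: fixing the sum is what saves one logarithm in the number of possible \<open>k\<close>.\<close>

lemma small_prod_dyadic_cover:
  fixes t :: "'n::finite \<Rightarrow> real"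
  assumes t: "\<And>i. t i \<le> 2" and prod: "(\<Prod>i\<in>UNIV. t i) < 1 / 2 ^ s"
  shows "\<exists>k. (\<Sum>i\<in>UNIV. k i) = s \<and> (\<forall>i. t i \<le> 2 / 2 ^ k i)"
proof -
  define \<kappa> where "\<kappa> = (\<lambda>i. Max {l \<in> {..s}. t i \<le> 2 / 2 ^ l})"
  have ne: "{l \<in> {..s}. t i \<le> 2 / 2 ^ l} \<noteq> {}" for i
    using t[of i] by (auto intro!: exI[of _ 0])
  have mem: "\<kappa> i \<le> s \<and> t i \<le> 2 / 2 ^ \<kappa> i" for i
    using Max_in[OF _ ne[of i]] unfolding \<kappa>_def by auto
  have "s \<le> (\<Sum>i\<in>UNIV. \<kappa> i)"
  proof (rule ccontr)
    assume less: "\<not> s \<le> (\<Sum>i\<in>UNIV. \<kappa> i)"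
    have "1 / 2 ^ \<kappa> i \<le> t i" for i
    proof (rule ccontr)
      assume ti: "\<not> 1 / 2 ^ \<kappa> i \<le> t i"
      have "\<kappa> i \<le> (\<Sum>i\<in>UNIV. \<kappa> i)" by (rule member_le_sum) auto
      then have "Suc (\<kappa> i) \<in> {l \<in> {..s}. t i \<le> 2 / 2 ^ l}" using ti less by auto
      then have "Suc (\<kappa> i) \<le> \<kappa> i" unfolding \<kappa>_def by (intro Max_ge) auto
      then show False by simp
    qed
    then have "(\<Prod>i\<in>UNIV. 1 / 2 ^ \<kappa> i) \<le> (\<Prod>i\<in>UNIV. t i)" by (intro prod_mono) auto
    then have "1 / 2 ^ (\<Sum>i\<in>UNIV. \<kappa> i) \<le> (\<Prod>i\<in>UNIV. t i)" by (simp add: prod_dividef power_sum)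
    moreover have "1 / 2 ^ s \<le> 1 / (2::real) ^ (\<Sum>i\<in>UNIV. \<kappa> i)"
      using less by (intro divide_left_mono power_increasing) auto
    ultimately show False using prod by linarith
  qed
  then obtain k where k: "\<forall>i. k i \<le> \<kappa> i" "(\<Sum>i\<in>UNIV. k i) = s"
    using ex_le_with_sum[of UNIV s \<kappa>] by auto
  have "t i \<le> 2 / 2 ^ k i" for i
  proof -
    have "2 / 2 ^ \<kappa> i \<le> 2 / (2::real) ^ k i" using k(1) by (intro divide_left_mono power_increasing) auto
    then show ?thesis using mem[of i] by linarith
  qed
  then show ?thesis using k(2) by blast
qed

text \<open>All values but one determine the last one, whence the exponent \<open>n - 1\<close>.\<close>

lemma card_compositions_le:
  shows "finite {k :: 'n::finite \<Rightarrow> nat. (\<Sum>i\<in>UNIV. k i) = s}"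
    and "card {k :: 'n::finite \<Rightarrow> nat. (\<Sum>i\<in>UNIV. k i) = s} \<le> (s + 1) ^ (CARD('n) - 1)"
proof -
  define a :: 'n where "a = undefined"
  let ?T = "{k :: 'n \<Rightarrow> nat. (\<Sum>i\<in>UNIV. k i) = s}"
  let ?P = "PiE (UNIV - {a}) (\<lambda>_. {..s})"
  let ?r = "\<lambda>k::'n \<Rightarrow> nat. restrict k (UNIV - {a})"
  have "inj_on ?r ?T"
  proof (rule inj_onI)
    fix k l assume kl: "k \<in> ?T" "l \<in> ?T" "?r k = ?r l"
    have off: "k i = l i" if "i \<noteq> a" for i
      using fun_cong[OF kl(3), of i] that by simp
    have "k a + (\<Sum>i\<in>UNIV - {a}. k i) = l a + (\<Sum>i\<in>UNIV - {a}. l i)"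
      using kl(1,2) sum.remove[of UNIV a k] sum.remove[of UNIV a l] by simp
    moreover have "(\<Sum>i\<in>UNIV - {a}. k i) = (\<Sum>i\<in>UNIV - {a}. l i)"
      by (rule sum.cong) (auto simp: off)
    ultimately have "k a = l a" by simp
    then show "k = l" using off by (intro ext) metis
  qed
  moreover have "?r ` ?T \<subseteq> ?P"
  proof
    fix g assume "g \<in> ?r ` ?T"
    then obtain k where k: "(\<Sum>i\<in>UNIV. k i) = s" "g = ?r k" by blast
    have "k i \<le> s" for i using member_le_sum[of i UNIV k] k(1) by simp
    then show "g \<in> ?P" using k by auto
  qed
  moreover have "finite ?P" by (intro finite_PiE) auto
  ultimately show "finite ?T" "card ?T \<le> (s + 1) ^ (CARD('n) - 1)"
    using inj_on_finite[of ?r ?T ?P] card_inj_on_le[of ?r ?T ?P] by (auto simp: card_PiE)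
qed

text \<open>Write \<open>x = w^(p+1)\<close>: then \<open>M^p x^M = (M w^M)^p w^M\<close>, where \<open>M w^M\<close> is bounded.\<close>

lemma summable_poly_times_geometric:
  fixes x :: real
  assumes "0 < x" "x < 1"
  shows "summable (\<lambda>M. real M ^ p * x ^ M)"
proof -
  define w where "w = x powr (1 / real (p + 1))"
  have w: "0 < w" "w < 1"
    using assms powr_less_mono'[of x 0 "1 / real (p + 1)"] by (auto simp: w_def)
  have "w ^ (p + 1) = w powr real (p + 1)" using w(1) by (simp only: powr_realpow)
  also have "\<dots> = x" unfolding w_def powr_powr using assms by simp
  finally have wp: "w ^ (p + 1) = x" .
  have "(\<lambda>M. real M * w ^ M) \<longlonglongrightarrow> 0" using w powser_times_n_limit_0[of w] by simp
  then have "Bseq (\<lambda>M. real M * w ^ M)" by (intro convergent_imp_Bseq) (auto simp: convergent_def)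
  then obtain B where B: "\<And>M. norm (real M * w ^ M) \<le> B" by (auto simp: Bseq_def)
  show ?thesis
  proof (rule summable_comparison_test')
    show "summable (\<lambda>M. B ^ p * w ^ M)" using w by (intro summable_mult summable_geometric) simp
    fix M
    have "real M ^ p * x ^ M = (real M * w ^ M) ^ p * w ^ M"
      by (simp add: wp[symmetric] power_mult_distrib mult_ac flip: power_mult)
    also have "\<dots> \<le> B ^ p * w ^ M"
      using B[of M] w by (intro mult_right_mono power_mono) auto
    finally show "norm (real M ^ p * x ^ M) \<le> B ^ p * w ^ M" using assms by simp
  qed
qed

text \<open>The terms \<open>\<psi> q (ln q)^p\<close> are not monotone, so the block \<open>[2^M, 2^(M+1))\<close> is bounded below by the smallest
  value of \<open>\<psi>\<close>, at its right end, and the smallest value of the logarithm, at its left end. The shift by one between the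
  two costs a constant factor only.\<close>

lemma summable_dyadic_condensation:
  fixes \<psi> :: "nat \<Rightarrow> real"
  assumes nonneg: "\<And>q. q \<ge> 1 \<Longrightarrow> 0 \<le> \<psi> q"
    and mono: "\<And>q r. q \<ge> 1 \<Longrightarrow> q \<le> r \<Longrightarrow> \<psi> r \<le> \<psi> q"
    and sum: "summable (\<lambda>q. \<psi> (Suc q) * ln (real (Suc q)) ^ p)"
  shows "summable (\<lambda>M. real M ^ p * 2 ^ M * \<psi> (2 ^ M))"
proof -
  define f where "f = (\<lambda>q. \<psi> q * ln (real q) ^ p)"
  define h where "h = (\<lambda>M. real M ^ p * 2 ^ M * \<psi> (2 ^ (M + 1)))"
  have f0: "0 \<le> f q" if "q \<ge> 1" for q
    unfolding f_def using that nonneg by (intro mult_nonneg_nonneg zero_le_power) auto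
  have h0: "0 \<le> h M" for M unfolding h_def using nonneg by simp
  have block: "ln 2 ^ p * h M \<le> (\<Sum>q\<in>{2 ^ M..<2 ^ (M + 1)}. f q)" for M
  proof -
    have "ln 2 ^ p * h M = (\<Sum>q\<in>{2 ^ M..<2 ^ (M + 1) :: nat}. \<psi> (2 ^ (M + 1)) * (real M * ln 2) ^ p)"
      by (simp add: h_def power_mult_distrib mult_ac)
    also have "\<dots> \<le> (\<Sum>q\<in>{2 ^ M..<2 ^ (M + 1)}. f q)"
    proof (rule sum_mono)
      fix q :: nat assume q: "q \<in> {2 ^ M..<2 ^ (M + 1)}"
      have q1: "1 \<le> q" using q by (metis atLeastLessThan_iff one_le_numeral one_le_power order_trans)
      have qM: "2 ^ M \<le> real q" using q by (metis atLeastLessThan_iff of_nat_le_iff of_nat_numeral of_nat_power)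
      have "real M * ln 2 = ln (2 ^ M)" by (simp add: ln_realpow)
      also have "\<dots> \<le> ln (real q)" using qM q1 by (subst ln_le_cancel_iff) auto
      finally have "(real M * ln 2) ^ p \<le> ln (real q) ^ p" by (intro power_mono) auto
      moreover have "\<psi> (2 ^ (M + 1)) \<le> \<psi> q" using mono[OF q1, of "2 ^ (M + 1)"] q by simp
      ultimately show "\<psi> (2 ^ (M + 1)) * (real M * ln 2) ^ p \<le> f q"
        unfolding f_def using nonneg[OF q1] by (intro mult_mono) auto
    qed
    finally show ?thesis .
  qed
  have "summable (\<lambda>M. ln 2 ^ p * h M)"
  proof (rule summableI_nonneg_bounded)
    show "0 \<le> ln 2 ^ p * h M" for M using h0 by simp
    fix N
    have "(\<Sum>M<N. ln 2 ^ p * h M) \<le> (\<Sum>M<N. \<Sum>q\<in>{2 ^ M..<2 ^ (M + 1)}. f q)"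
      by (intro sum_mono block)
    also have "\<dots> = (\<Sum>q\<in>{1..<2 ^ N}. f q)"
    proof (induction N)
      case (Suc N)
      have "{1..<2 ^ Suc N} = {1..<2 ^ N} \<union> {2 ^ N..<2 ^ (N + 1) :: nat}"
        by (auto simp: le_less_trans one_le_power[THEN order_trans])
      then show ?case using Suc by (simp add: sum.union_disjoint)
    qed simp
    also have "\<dots> = (\<Sum>q<2 ^ N - 1. f (Suc q))"
      using sum.shift_bounds_Suc_ivl[of f 0 "2 ^ N - 1"] by (simp add: atLeast0LessThan)
    also have "\<dots> \<le> (\<Sum>q. f (Suc q))"
    proof (rule sum_le_suminf)
      show "summable (\<lambda>q. f (Suc q))" using sum unfolding f_def .
    qed (simp_all add: f0)
    finally show "(\<Sum>M<N. ln 2 ^ p * h M) \<le> (\<Sum>q. f (Suc q))" .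
  qed
  then have "summable h" by simp
  then have sh: "summable (\<lambda>M. 2 * 2 ^ p * h M)" by (rule summable_mult)
  have "summable (\<lambda>M. real (M + 1) ^ p * 2 ^ (M + 1) * \<psi> (2 ^ (M + 1)))"
  proof (rule summable_comparison_test'[OF sh])
    fix M :: nat assume M: "1 \<le> M"
    have "real (M + 1) ^ p \<le> (2 * real M) ^ p" using M by (intro power_mono) auto
    then have "real (M + 1) ^ p * (2 ^ (M + 1) * \<psi> (2 ^ (M + 1))) \<le>
        (2 * real M) ^ p * (2 ^ (M + 1) * \<psi> (2 ^ (M + 1)))"
      using nonneg by (intro mult_right_mono) auto
    moreover have "0 \<le> real (M + 1) ^ p * 2 ^ (M + 1) * \<psi> (2 ^ (M + 1))"
      using nonneg by simp
    ultimately show "norm (real (M + 1) ^ p * 2 ^ (M + 1) * \<psi> (2 ^ (M + 1))) \<le> 2 * 2 ^ p * h M"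
      by (simp add: h_def power_mult_distrib mult_ac)
  qed
  then show ?thesis by (subst (asm) summable_iff_shift)
qed

section \<open>The convergence theorem\<close>

lemma mult_approx_set_borel [measurable]: "mult_approx_set \<psi> \<in> sets borel"
proof -
  have "{x :: real ^ 'n. (\<Prod>i\<in>UNIV. nint_dist (real q * x $ i)) < \<psi> q} \<in> sets borel" for q
    by measurable
  then have "(\<Union>q\<in>{m..} \<inter> {1..}. {x :: real ^ 'n. (\<Prod>i\<in>UNIV. nint_dist (real q * x $ i)) < \<psi> q}) \<in> sets borel" for m
    by (intro sets.countable_UN'') auto
  then have "(\<Inter>m. \<Union>q\<in>{m..} \<inter> {1..}. {x :: real ^ 'n. (\<Prod>i\<in>UNIV. nint_dist (real q * x $ i)) < \<psi> q}) \<in> sets borel"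
    by (intro sets.countable_INT'') auto
  also have "(\<Inter>m. \<Union>q\<in>{m..} \<inter> {1..}. {x :: real ^ 'n. (\<Prod>i\<in>UNIV. nint_dist (real q * x $ i)) < \<psi> q}) =
      mult_approx_set \<psi>"
    by (auto simp: mult_approx_set_def infinite_nat_iff_unbounded_le)
  finally show ?thesis .
qed

theorem theorem1p7:
  fixes L :: "(real ^ 'n) set" and d :: nat
  assumes "1 \<le> d" and "d < CARD('n)"
    and "affine L" and "aff_dim L = int d"
    and "hypothesis_D d L"
  shows "convergent_gallagher (induced_lebesgue d L)"
proof -
  define \<mu> where "\<mu> = induced_lebesgue d L"
  define p where "p = CARD('n) - 1"
  have \<mu>: "flat_measure L \<mu>" unfolding \<mu>_def using assms(3,4) by (rule flat_measure_induced_lebesgue)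
  then have sets [simp]: "sets \<mu> = sets borel" and fin: "\<And>R. emeasure \<mu> (cball 0 R) < \<infinity>"
    by (auto simp: flat_measure_def)
  obtain c \<gamma> where surj: "surjective_projections d L" and c: "c > 0"
    and \<gamma>: "(real CARD('n) - real d) / real CARD('n) \<le> \<gamma>" "\<gamma> < 1"
    and D: "\<And>\<sigma>. 1 / (real CARD('n) - real d) \<le> \<sigma> \<Longrightarrow> \<sigma> \<le> 1 \<Longrightarrow>
      hypothesis_D_at d L c (\<gamma> * (1 + real d * \<sigma>)) \<sigma>"
    using assms(5) unfolding hypothesis_D_def by blast
  have "0 < (real CARD('n) - real d) / real CARD('n)" using assms(2) by simp
  then have \<gamma>0: "0 < \<gamma>" using \<gamma>(1) by linarith
  have "mult_approx_set \<psi> \<in> null_sets \<mu>"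
    if \<psi>: "\<forall>q\<ge>1. 0 \<le> \<psi> q \<and> \<psi> q < 1" and mono: "\<forall>q\<ge>1. \<forall>r\<ge>q. \<psi> r \<le> \<psi> q"
      and sum: "summable (\<lambda>q. \<psi> (Suc q) * ln (real (Suc q)) ^ (CARD('n) - 1))" for \<psi> :: "nat \<Rightarrow> real"
  proof -
    \<comment> \<open>The second entry of the maximum ensures \<open>\<gamma> s \<le> M\<close> below. Its contribution \<open>M^p 2^((1 - 1/\<gamma>) M)\<close> is
      summable as \<open>\<gamma> < 1\<close>.\<close>
    define \<Psi> where "\<Psi> = (\<lambda>M::nat. max (\<psi> (2 ^ M)) (2 powr (- (real M / \<gamma>))))"
    have \<psi>M: "0 \<le> \<psi> (2 ^ M)" "\<psi> (2 ^ M) < 1" for M using \<psi> by (simp_all add: one_le_power)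
    have \<Psi>: "0 < \<Psi> M" "\<Psi> M \<le> 1" for M
    proof -
      have "0 < 2 powr (- (real M / \<gamma>))" by simp
      then show "0 < \<Psi> M" unfolding \<Psi>_def by linarith
      have "2 powr (- (real M / \<gamma>)) \<le> 2 powr 0" using \<gamma>0 by (intro powr_mono) auto
      then show "\<Psi> M \<le> 1" unfolding \<Psi>_def using \<psi>M[of M] by simp
    qed
    define s where "s = (\<lambda>M. nat \<lfloor>log 2 (1 / \<Psi> M)\<rfloor>)"
    have s: "2 ^ s M \<le> 1 / \<Psi> M" "1 / \<Psi> M \<le> 2 * 2 ^ s M" "\<gamma> * real (s M) \<le> real M" for M
    proof -
      define l where "l = log 2 (1 / \<Psi> M)"
      have "1 \<le> 1 / \<Psi> M" using \<Psi>[of M] by simp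
      then have l0: "0 \<le> l" unfolding l_def using \<Psi>(1)[of M] by (subst zero_le_log_cancel_iff) auto
      have l: "2 powr l = 1 / \<Psi> M" unfolding l_def using \<Psi>(1)[of M] by simp
      have sl: "real (s M) \<le> l" "l \<le> real (s M) + 1" using l0 unfolding s_def l_def by linarith+
      have "2 powr real (s M) \<le> 2 powr l" using sl by (intro powr_mono) auto
      then show "2 ^ s M \<le> 1 / \<Psi> M" by (simp add: l powr_realpow)
      have "2 powr l \<le> 2 powr (real (s M) + 1)" using sl by (intro powr_mono) auto
      then show "1 / \<Psi> M \<le> 2 * 2 ^ s M" by (simp add: l powr_realpow powr_add)
      have "2 powr (- (real M / \<gamma>)) \<le> \<Psi> M" by (simp add: \<Psi>_def)
      then have "1 / \<Psi> M \<le> 1 / 2 powr (- (real M / \<gamma>))" using \<Psi>(1)[of M] by (intro divide_left_mono) auto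
      then have "2 powr l \<le> 2 powr (real M / \<gamma>)" by (simp add: l powr_minus divide_inverse)
      then have "l \<le> real M / \<gamma>" by simp
      then have "real (s M) \<le> real M / \<gamma>" using sl by linarith
      then show "\<gamma> * real (s M) \<le> real M" using \<gamma>0 by (simp add: pos_le_divide_eq mult.commute)
    qed
    define T where "T = (\<lambda>M. {k :: 'n \<Rightarrow> nat. (\<Sum>i\<in>UNIV. k i) = s M})"
    have T: "finite (T M)" "card (T M) \<le> (s M + 1) ^ p" for M
      unfolding T_def p_def by (rule card_compositions_le)+
    have cover: "\<exists>k\<in>T M. x \<in> near_box (real R) M k"
      if x: "x \<in> cball 0 (real R)" and q: "q \<in> {2 ^ M..<2 ^ (M + 1)}"
        and pr: "(\<Prod>i\<in>UNIV. nint_dist (real q * x $ i)) < \<psi> q" for x :: "real ^ 'n" and R q M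
    proof -
      have "\<psi> q \<le> \<psi> (2 ^ M)" using mono q by (simp add: one_le_power)
      also have "\<dots> \<le> \<Psi> M" by (simp add: \<Psi>_def)
      also have "\<dots> \<le> 1 / 2 ^ s M" using s(1)[of M] \<Psi>(1)[of M] by (simp add: field_simps)
      finally have "(\<Prod>i\<in>UNIV. nint_dist (real q * x $ i)) < 1 / 2 ^ s M" using pr by linarith
      moreover have "nint_dist (real q * x $ i) \<le> 2" for i
        using nint_dist_le_half[of "real q * x $ i"] by linarith
      ultimately obtain k where k: "(\<Sum>i\<in>UNIV. k i) = s M" "\<forall>i. nint_dist (real q * x $ i) \<le> 2 / 2 ^ k i"
        using small_prod_dyadic_cover[of "\<lambda>i. nint_dist (real q * x $ i)" "s M"] by blast
      then have "k \<in> T M" "x \<in> near_box (real R) M k"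
        using x q unfolding T_def near_box_def by blast+
      then show ?thesis by blast
    qed
    have "mult_approx_set \<psi> \<inter> cball 0 (real R) \<in> null_sets \<mu>" if R: "R \<ge> 1" for R :: nat
    proof -
      obtain C where C: "C \<ge> 0" "\<And>m k. m \<ge> 3 \<Longrightarrow> \<gamma> * real (\<Sum>i\<in>UNIV. k i) \<le> real m \<Longrightarrow>
          emeasure \<mu> (near_box (real R) m k) \<le> ennreal (C * 2 ^ m / 2 ^ (\<Sum>i\<in>UNIV. k i))"
        using near_box_measure[OF assms(3,4,2) \<mu> surj less_imp_le[OF \<gamma>0] c R D] by blast
      \<comment> \<open>Blocks are shifted by 3 because the measure estimate starts there.\<close>
      define A where "A = (\<lambda>m. \<Union>k\<in>T (m + 3). near_box (real R) (m + 3) k)"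
      have Ab: "A m \<in> sets \<mu>" for m unfolding A_def using T by (auto intro!: sets.finite_UN)
      define G where "G = (\<lambda>M. 2 * C * (1 / \<gamma> + 1) ^ p *
          (real M ^ p * 2 ^ M * \<psi> (2 ^ M) + real M ^ p * (2 powr (1 - 1 / \<gamma>)) ^ M))"
      have G0: "0 \<le> G M" for M
        unfolding G_def using C(1) \<gamma>0 \<psi>M by (intro mult_nonneg_nonneg add_nonneg_nonneg) auto
      have A_le: "emeasure \<mu> (A m) \<le> ennreal (G (m + 3))" for m
      proof -
        define M where "M = m + 3"
        have M: "M \<ge> 3" by (simp add: M_def)
        have "emeasure \<mu> (A m) \<le> (\<Sum>k\<in>T M. emeasure \<mu> (near_box (real R) M k))"
          unfolding A_def M_def[symmetric] using T by (intro emeasure_subadditive_finite) auto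
        also have "\<dots> \<le> (\<Sum>k\<in>T M. ennreal (C * 2 ^ M / 2 ^ s M))"
        proof (rule sum_mono)
          fix k assume "k \<in> T M"
          then have k: "(\<Sum>i\<in>UNIV. k i) = s M" by (simp add: T_def)
          show "emeasure \<mu> (near_box (real R) M k) \<le> ennreal (C * 2 ^ M / 2 ^ s M)"
            using C(2)[OF M, of k] s(3)[of M] by (simp only: k)
        qed
        also have "\<dots> = ennreal (real (card (T M)) * (C * 2 ^ M / 2 ^ s M))"
          using C(1) by (subst sum_ennreal) auto
        also have "\<dots> \<le> ennreal (G M)"
        proof (rule ennreal_leI)
          have "real (s M) + 1 \<le> real M * (1 / \<gamma> + 1)"
          proof -
            have "real (s M) \<le> real M / \<gamma>" using s(3)[of M] \<gamma>0 by (simp add: pos_le_divide_eq mult.commute)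
            then show ?thesis using M by (simp add: distrib_left)
          qed
          then have "(real (s M) + 1) ^ p \<le> (real M * (1 / \<gamma> + 1)) ^ p" by (intro power_mono) auto
          moreover have "real (card (T M)) \<le> real ((s M + 1) ^ p)" by (rule of_nat_mono[OF T(2)])
          ultimately have card: "real (card (T M)) \<le> real M ^ p * (1 / \<gamma> + 1) ^ p"
            by (simp add: power_mult_distrib add.commute)
          have inv: "1 / 2 ^ s M \<le> 2 * \<Psi> M"
            using s(2)[of M] \<Psi>(1)[of M] by (simp add: field_simps)
          have geo: "2 ^ M * 2 powr (- (real M / \<gamma>)) = (2 powr (1 - 1 / \<gamma>)) ^ M"
            by (simp add: powr_powr left_diff_distrib flip: powr_realpow powr_add)
          have "real (card (T M)) * (C * 2 ^ M / 2 ^ s M) = real (card (T M)) * (C * 2 ^ M * (1 / 2 ^ s M))"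
            by simp
          also have "\<dots> \<le> (real M ^ p * (1 / \<gamma> + 1) ^ p) * (C * 2 ^ M * (2 * \<Psi> M))"
            using C(1) card inv \<gamma>0 by (intro mult_mono mult_left_mono) auto
          also have "\<dots> = 2 * C * (1 / \<gamma> + 1) ^ p * (real M ^ p * (2 ^ M * \<Psi> M))" by (simp only: mult_ac)
          also have "\<dots> \<le> G M"
            unfolding G_def
          proof (rule mult_left_mono)
            have "\<Psi> M \<le> \<psi> (2 ^ M) + 2 powr (- (real M / \<gamma>))"
              unfolding \<Psi>_def using \<psi>M(1)[of M] by simp
            then have "real M ^ p * (2 ^ M * \<Psi> M) \<le>
                real M ^ p * (2 ^ M * (\<psi> (2 ^ M) + 2 powr (- (real M / \<gamma>))))"
              by (intro mult_left_mono) auto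
            then show "real M ^ p * (2 ^ M * \<Psi> M) \<le>
                real M ^ p * 2 ^ M * \<psi> (2 ^ M) + real M ^ p * (2 powr (1 - 1 / \<gamma>)) ^ M"
              unfolding geo[symmetric] by (simp add: distrib_left mult.assoc)
            show "0 \<le> 2 * C * (1 / \<gamma> + 1) ^ p" using C(1) \<gamma>0 by simp
          qed
          finally show "real (card (T M)) * (C * 2 ^ M / 2 ^ s M) \<le> G M" .
        qed
        finally show ?thesis by (simp add: M_def)
      qed
      have "summable G"
        unfolding G_def
      proof (intro summable_mult summable_add)
        show "summable (\<lambda>M. real M ^ p * 2 ^ M * \<psi> (2 ^ M))"
          by (rule summable_dyadic_condensation) (use \<psi> mono sum in \<open>auto simp: p_def\<close>)
        have "2 powr (1 - 1 / \<gamma>) < 2 powr 0" using \<gamma>0 \<gamma>(2) by (intro powr_less_mono) auto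
        then show "summable (\<lambda>M. real M ^ p * (2 powr (1 - 1 / \<gamma>)) ^ M)"
          by (intro summable_poly_times_geometric) auto
      qed
      then have sG: "summable (\<lambda>m. G (m + 3))" by (rule summable_ignore_initial_segment)
      have null: "limsup A \<in> null_sets \<mu>"
      proof (rule borel_cantelli_limsup1[OF Ab])
        show "emeasure \<mu> (A m) < \<infinity>" for m
          using le_less_trans[OF A_le[of m] ennreal_less_top] by simp
        show "summable (\<lambda>m. measure \<mu> (A m))"
        proof (rule summable_comparison_test'[OF sG])
          fix m
          have "measure \<mu> (A m) \<le> G (m + 3)"
            unfolding measure_def by (rule enn2real_leI[OF G0 A_le])
          then show "norm (measure \<mu> (A m)) \<le> G (m + 3)" by simp
        qed
      qed
      have sub: "mult_approx_set \<psi> \<inter> cball 0 (real R) \<subseteq> limsup A"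
      proof
        fix x :: "real ^ 'n" assume x: "x \<in> mult_approx_set \<psi> \<inter> cball 0 (real R)"
        have "\<exists>m\<ge>n. x \<in> A m" for n
        proof -
          obtain q where q: "q \<ge> 2 ^ (n + 3)" "q \<ge> 1" "(\<Prod>i\<in>UNIV. nint_dist (real q * x $ i)) < \<psi> q"
            using x unfolding mult_approx_set_def infinite_nat_iff_unbounded_le by blast
          obtain M where M: "2 ^ M \<le> q" "q < 2 ^ (M + 1)" using ex_power_ivl1[of 2 q] q(2) by auto
          have "(2::nat) ^ (n + 3) < 2 ^ (M + 1)" using q(1) M(2) by linarith
          then have "n + 3 < M + 1" by (rule power_less_imp_less_exp[rotated]) simp
          then have Mn: "M = (M - 3) + 3" "M - 3 \<ge> n" by auto
          obtain k where "k \<in> T M" "x \<in> near_box (real R) M k"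
            using cover[of x R q M] x q(3) M by auto
          then have "x \<in> A (M - 3)" unfolding A_def Mn(1)[symmetric] by blast
          then show ?thesis using Mn(2) by blast
        qed
        then show "x \<in> limsup A" by (auto simp: limsup_INF_SUP)
      qed
      show ?thesis by (rule null_sets_subset[OF null _ sub]) simp
    qed
    then have "(\<Union>R. mult_approx_set \<psi> \<inter> cball 0 (real (Suc R))) \<in> null_sets \<mu>"
      by (intro null_sets_UN) (simp del: of_nat_Suc)
    moreover have "(\<Union>R. mult_approx_set \<psi> \<inter> cball 0 (real (Suc R))) = (mult_approx_set \<psi> :: (real ^ 'n) set)"
    proof -
      have "\<exists>R. norm x \<le> real (Suc R)" for x :: "real ^ 'n"
      proof -
        obtain R :: nat where "norm x \<le> real R" using real_arch_simple by blast
        then show ?thesis by (intro exI[of _ R]) simp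
      qed
      then show ?thesis by auto
    qed
    ultimately show ?thesis by simp
  qed
  then show ?thesis unfolding convergent_gallagher_def \<mu>_def[symmetric] by simp
qed

end
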